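(* Let $G$ be a connected $1$-tough graph of order $n\geq 18$ with minimum degree $\delta\geq 2$. If $\rho(G)\geq\rho(M_{n})$, then $G$ contains a hamiltonian cycle, unless $G\cong M_{n}$.
   Context: Graphs are finite, simple and undirected. For a graph $G$, $A(G)$ is its adjacency matrix and $\rho(G)$, the spectral radius of $G$, is the largest eigenvalue of $A(G)$. $c(G)$ denotes the number of connected components of $G$. For a real number $t$, a graph $G$ is $t$-tough if $|S|\geq t\,c(G-S)$ for every subset $S\subseteq V(G)$ with $c(G-S)>1$. $K_m$ is the complete graph on $m$ vertices, $\cup$ denotes disjoint union, $3K_1$ is the graph consisting of three isolated vertices, and $G_1\nabla G_2$ is the join of $G_1$ and $G_2$, obtained from their disjoint union by adding all edges between $V(G_1)$ and $V(G_2)$. $K_{n-4}^{+3}$ is the graph (on $n-1$ vertices) obtained from $3K_{1}\cup K_{n-4}$ by adding three independent (i.e. pairwise vertex-disjoint) edges between $3K_{1}$ and $K_{n-4}$, and $M_{n}=K_{1}\nabla K_{n-4}^{+3}$. A hamiltonian cycle of $G$ is a cycle of $G$ through all vertices of $G$. *)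

theory Defs
  imports
    "Jordan_Normal_Form.Spectral_Radius"
    "Graph_Theory.Digraph_Component"
    "Graph_Theory.Digraph_Isomorphism"
begin

text \<open>
  Finite simple undirected graphs are represented, as is usual for \<open>Graph_Theory\<close>, by the locale
  \<^locale>\<open>pair_graph\<close>: a finite vertex set with a symmetric and irreflexive set of arcs, an
  undirected edge \<open>uv\<close> being the pair of arcs \<open>(u, v)\<close> and \<open>(v, u)\<close>.
\<close>

text \<open>
  Matrices are indexed by \<open>{0..<n}\<close>, so the adjacency matrix needs an enumeration of the vertices.
  A different enumeration conjugates the matrix by a permutation matrix; the spectrum is unaffected.
\<close>

definition vertex_list :: "'a pair_pre_digraph \<Rightarrow> 'a list" where
  "vertex_list G = (SOME vs. distinct vs \<and> set vs = pverts G)"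

definition adjacency_matrix :: "'a pair_pre_digraph \<Rightarrow> real mat" where
  "adjacency_matrix G =
    mat (card (pverts G)) (card (pverts G))
      (\<lambda>(i, j). if (vertex_list G ! i, vertex_list G ! j) \<in> parcs G then 1 else 0)"

text \<open>
  The matrix is real and symmetric, so \<^const>\<open>spectrum\<close> over the reals contains all its eigenvalues.
  The paper's spectral radius is the largest eigenvalue, not the largest modulus as in
  \<^const>\<open>spectral_radius\<close>.
\<close>

definition graph_spectral_radius :: "'a pair_pre_digraph \<Rightarrow> real" (\<open>\<rho>\<close>) where
  "\<rho> G = Max (spectrum (adjacency_matrix G))"

definition components :: "('a, 'b) pre_digraph \<Rightarrow> ('a, 'b) pre_digraph set" where
  "components G = {H. pre_digraph.max_subgraph G Digraph_Component.connected H}"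

definition num_components :: "('a, 'b) pre_digraph \<Rightarrow> nat" where
  "num_components G = card (components G)"

definition delete_verts :: "('a, 'b) pre_digraph \<Rightarrow> 'a set \<Rightarrow> ('a, 'b) pre_digraph" where
  "delete_verts G S = G \<restriction> (verts G - S)"

definition tough :: "real \<Rightarrow> ('a, 'b) pre_digraph \<Rightarrow> bool" where
  "tough t G \<longleftrightarrow>
    (\<forall>S \<subseteq> verts G. num_components (delete_verts G S) > 1 \<longrightarrow>
       real (card S) \<ge> t * real (num_components (delete_verts G S)))"

text \<open>In a symmetric digraph the out-degree of a vertex is its number of incident undirected edges.\<close>

definition min_degree :: "('a, 'b) pre_digraph \<Rightarrow> nat" where
  "min_degree G = Min (out_degree G ` verts G)"

text \<open>
  \<^const>\<open>pre_digraph.cycle\<close> admits the closed walk \<open>u, v, u\<close> along a single undirected edge, whence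
  the bound on the length. The vertices of a cycle are the tails of its arcs.
\<close>

definition hamiltonian_cycle :: "('a, 'b) pre_digraph \<Rightarrow> 'b list \<Rightarrow> bool" where
  "hamiltonian_cycle G p \<longleftrightarrow>
    pre_digraph.cycle G p \<and> length p \<ge> 3 \<and> tail G ` set p = verts G"

definition complete_graph :: "nat \<Rightarrow> nat pair_pre_digraph" where
  "complete_graph m = \<lparr> pverts = {..<m}, parcs = {(u, v). u < m \<and> v < m \<and> u \<noteq> v} \<rparr>"

definition empty_graph :: "nat \<Rightarrow> nat pair_pre_digraph" where
  "empty_graph m = \<lparr> pverts = {..<m}, parcs = {} \<rparr>"

definition disjoint_union ::
    "'a pair_pre_digraph \<Rightarrow> 'b pair_pre_digraph \<Rightarrow> ('a + 'b) pair_pre_digraph" where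
  "disjoint_union G H =
    \<lparr> pverts = pverts G <+> pverts H,
      parcs = map_prod Inl Inl ` parcs G \<union> map_prod Inr Inr ` parcs H \<rparr>"

definition add_edges :: "'a pair_pre_digraph \<Rightarrow> ('a \<times> 'a) set \<Rightarrow> 'a pair_pre_digraph" where
  "add_edges G E = \<lparr> pverts = pverts G, parcs = parcs G \<union> E \<union> E\<inverse> \<rparr>"

definition graph_join ::
    "'a pair_pre_digraph \<Rightarrow> 'b pair_pre_digraph \<Rightarrow> ('a + 'b) pair_pre_digraph" (infixr \<open>\<nabla>\<close> 65) where
  "G \<nabla> H =
    add_edges (disjoint_union G H) {(Inl u, Inr v) | u v. u \<in> pverts G \<and> v \<in> pverts H}"

text \<open>
  \<open>K\<^sub>m\<^sup>+\<^sup>3\<close>, for \<open>m \<ge> 3\<close>. The three independent edges join the \<open>i\<close>-th isolated vertex to the \<open>i\<close>-th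
  vertex of \<open>K\<^sub>m\<close>; up to isomorphism this choice is immaterial.
\<close>

definition complete_plus3 :: "nat \<Rightarrow> (nat + nat) pair_pre_digraph" where
  "complete_plus3 m =
    add_edges (disjoint_union (empty_graph 3) (complete_graph m)) {(Inl i, Inr i) | i. i < 3}"

definition M_graph :: "nat \<Rightarrow> (nat + nat + nat) pair_pre_digraph" where
  "M_graph n = complete_graph 1 \<nabla> complete_plus3 (n - 4)"

end

theory Submission
  imports "HOL-Analysis.Function_Topology" Defs
begin

text \<open>
  Suppose \<open>G\<close> is not hamiltonian and take an edge-maximal nonhamiltonian graph \<open>F\<close> on the same
  vertices containing \<open>G\<close>. It is still 1-tough with minimum degree at least 2, its spectral radius
  exceeds \<open>n - 4\<close>, and by the theorem of Bondy and Chvatal nonadjacent vertices have degree sum below \<open>n\<close>.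
  The spectral radius forces so many edges that any two nonadjacent vertices include one of
  degree at most 3 and there are at most three such vertices; hence \<open>F\<close> has a clique \<open>X\<close> on
  \<open>n - 3\<close> vertices. A hamiltonian cycle arises as soon as the three vertices outside \<open>X\<close>
  lie on one path with both ends in \<open>X\<close>, and toughness provides such a path unless they are
  independent of degree 2 with a single common neighbour, that is, unless \<open>F\<close> is \<open>M\<^sub>n\<close>. Then
  \<open>G\<close> is a spanning subgraph of the connected graph \<open>M\<^sub>n\<close> with the same spectral radius, so it
  is \<open>M\<^sub>n\<close>.
\<close>

section \<open>The largest eigenvalue as a Rayleigh maximum\<close>

text \<open>The bound \<open>n - 4\<close> comes from a clique on \<open>n - 3\<close> vertices
  inside \<open>M_graph n\<close> with further edges attached to it. Maximality of \<open>F\<close>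
  pays twice. In the whole graph the degree-sum condition limits nonadjacent pairs of large degree.
  Near the clique it acts locally: a clique vertex with a neighbour outside has degree at least
  \<open>n - 3\<close>, so it is adjacent to every outside vertex of degree at least 3. This leaves
  the outside vertices so little freedom that a handful of explicit paths settles all cases.
  Toughness enters only through cut sets of at most three vertices.\<close>

locale ugraph =
  fixes V :: "'a set" and E :: "('a \<times> 'a) set"
  assumes finite_V: "finite V"
    and edge_verts: "E \<subseteq> V \<times> V"
    and sym_E: "sym E"
    and irrefl_E: "irrefl E"
begin

lemma edge_sym: "(u, v) \<in> E \<longleftrightarrow> (v, u) \<in> E"
  using sym_E by (auto dest: symD)

lemma no_loop: "(v, v) \<notin> E"
  using irrefl_E by (auto simp: irrefl_def)

lemma finite_E: "finite E"
  using finite_subset[OF edge_verts] finite_V by auto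

lemma nbrs_subset: "E `` A \<subseteq> V"
  using edge_verts by auto

lemma finite_nbrs: "finite (E `` A)"
  using nbrs_subset finite_V by (rule finite_subset)

lemma E_Sigma: "E = (SIGMA v:V. E `` {v})"
  using edge_verts by auto

lemma sum_over_edges: "(\<Sum>e\<in>E. f e) = (\<Sum>u\<in>V. \<Sum>v\<in>E `` {u}. f (u, v))"
proof -
  have "(\<Sum>u\<in>V. \<Sum>v\<in>E `` {u}. f (u, v)) = (\<Sum>(u, v)\<in>(SIGMA u:V. E `` {u}). f (u, v))"
    by (rule sum.Sigma) (auto simp: finite_V finite_nbrs)
  then show ?thesis
    using E_Sigma by simp
qed

lemma sum_over_edges_swap: "(\<Sum>(u, v)\<in>E. f u v) = (\<Sum>(u, v)\<in>E. f v u)"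
  by (rule sum.reindex_bij_witness[where i = prod.swap and j = prod.swap])
     (auto simp: edge_sym)

lemma handshake: "card E = (\<Sum>v\<in>V. card (E `` {v}))"
  using sum_over_edges[where f = "\<lambda>_. 1::nat"] by simp

end

text \<open>The quadratic form of the adjacency matrix. Both arcs of an edge lie in
  \<open>E\<close>, so every edge contributes twice.\<close>

definition qform :: "('a \<times> 'a) set \<Rightarrow> ('a \<Rightarrow> real) \<Rightarrow> real" where
  "qform E x = (\<Sum>(u, v)\<in>E. x u * x v)"

text \<open>The largest eigenvalue, encoded by the two properties that the argument uses: it bounds
  the Rayleigh quotient, and it has a nonnegative eigenvector. Together they determine
  \<open>r\<close>, without any enumeration of the vertices.\<close>

definition graph_index :: "'a set \<Rightarrow> ('a \<times> 'a) set \<Rightarrow> real \<Rightarrow> bool" where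
  "graph_index V E r \<longleftrightarrow>
     (\<forall>x. qform E x \<le> r * (\<Sum>v\<in>V. (x v)\<^sup>2)) \<and>
     (\<exists>x. (\<forall>v. 0 \<le> x v) \<and> (\<exists>v\<in>V. x v \<noteq> 0) \<and> (\<forall>u\<in>V. (\<Sum>v\<in>E `` {u}. x v) = r * x u))"

context ugraph
begin

lemma qform_eq: "qform E x = (\<Sum>u\<in>V. x u * (\<Sum>v\<in>E `` {u}. x v))"
  unfolding qform_def by (simp add: sum_over_edges sum_distrib_left)

lemma qform_eigenvector:
  assumes "\<forall>u\<in>V. (\<Sum>v\<in>E `` {u}. x v) = r * x u"
  shows "qform E x = r * (\<Sum>v\<in>V. (x v)\<^sup>2)"
proof -
  have "qform E x = (\<Sum>u\<in>V. x u * (r * x u))"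
    unfolding qform_eq using assms by (intro sum.cong) auto
  then show ?thesis
    by (simp add: sum_distrib_left power2_eq_square mult_ac)
qed

lemma norm2_pos: "v \<in> V \<Longrightarrow> x v \<noteq> 0 \<Longrightarrow> (\<Sum>v\<in>V. (x v)\<^sup>2) > (0 :: real)"
  using finite_V by (intro sum_pos2[where i = v]) auto

text \<open>First-order condition in the single coordinate \<open>w\<close>: adding \<open>t\<close>
  there changes the form by \<open>2 * t * S\<close> only, since there is no loop at
  \<open>w\<close>, and the squared norm by \<open>2 * t * x w + t\<^sup>2\<close>. A suitable small
  \<open>t\<close> breaks the bound unless \<open>S = r * x w\<close>.\<close>

lemma maximizer_is_eigenvector:
  assumes le: "\<And>y. qform E y \<le> r * (\<Sum>v\<in>V. (y v)\<^sup>2)"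
    and eq: "qform E x = r * (\<Sum>v\<in>V. (x v)\<^sup>2)"
    and w: "w \<in> V"
  shows "(\<Sum>v\<in>E `` {w}. x v) = r * x w"
proof (rule ccontr)
  define S where "S = (\<Sum>v\<in>E `` {w}. x v)"
  define e :: "'a \<Rightarrow> real" where "e = (\<lambda>v. if v = w then 1 else 0)"
  assume "\<not> ?thesis"
  then have D: "S - r * x w \<noteq> 0"
    by (simp add: S_def)
  have lin: "(\<Sum>(u, v)\<in>E. e u * x v) = S"
  proof -
    have "(\<Sum>(u, v)\<in>E. e u * x v) = (\<Sum>u\<in>V. \<Sum>v\<in>E `` {u}. e u * x v)"
      by (simp add: sum_over_edges)
    also have "\<dots> = (\<Sum>u\<in>V. if u = w then S else 0)"
      by (intro sum.cong) (auto simp: e_def S_def)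
    finally show ?thesis
      using w finite_V by simp
  qed
  have lin': "(\<Sum>(u, v)\<in>E. x u * e v) = S"
    using sum_over_edges_swap[of "\<lambda>u v. x u * e v"] lin by (simp add: mult.commute)
  have quad: "(\<Sum>(u, v)\<in>E. e u * e v) = 0"
    using no_loop by (intro sum.neutral) (auto simp: e_def)
  have q: "qform E (\<lambda>v. x v + t * e v) = qform E x + 2 * t * S" for t
  proof -
    have "qform E (\<lambda>v. x v + t * e v) =
        (\<Sum>(u, v)\<in>E. x u * x v + t * (e u * x v) + t * (x u * e v) + t\<^sup>2 * (e u * e v))"
      unfolding qform_def by (intro sum.cong) (auto simp: algebra_simps power2_eq_square)
    also have "\<dots> = qform E x + t * (\<Sum>(u, v)\<in>E. e u * x v)
        + t * (\<Sum>(u, v)\<in>E. x u * e v) + t\<^sup>2 * (\<Sum>(u, v)\<in>E. e u * e v)"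
      by (simp add: qform_def sum.distrib sum_distrib_left case_prod_unfold)
    finally show ?thesis
      by (simp add: lin lin' quad)
  qed
  have n: "(\<Sum>v\<in>V. (x v + t * e v)\<^sup>2) = (\<Sum>v\<in>V. (x v)\<^sup>2) + 2 * t * x w + t\<^sup>2" for t
  proof -
    have "(\<Sum>v\<in>V. (x v + t * e v)\<^sup>2) = (\<Sum>v\<in>V. (x v)\<^sup>2 + (if v = w then 2 * t * x w + t\<^sup>2 else 0))"
      by (intro sum.cong) (auto simp: e_def power2_sum)
    also have "\<dots> = (\<Sum>v\<in>V. (x v)\<^sup>2) + (2 * t * x w + t\<^sup>2)"
      using w finite_V by (simp add: sum.distrib)
    finally show ?thesis by simp
  qed
  define D where "D = S - r * x w"
  have ineq: "2 * t * D \<le> r * t\<^sup>2" for t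
    using le[of "\<lambda>v. x v + t * e v"] eq unfolding q n D_def by (simp add: algebra_simps)
  \<comment> \<open>This choice turns the inequality into
    \<open>2 * (\<bar>r\<bar> + 1) \<le> r\<close> after cancelling the square of \<open>t\<close>,
    which is absurd for either sign of \<open>r\<close>.\<close>
  define t where "t = D / (\<bar>r\<bar> + 1)"
  have tp: "D = t * (\<bar>r\<bar> + 1)" and t0: "t \<noteq> 0"
    using D by (auto simp: t_def D_def)
  have "t\<^sup>2 * (2 * (\<bar>r\<bar> + 1)) \<le> t\<^sup>2 * r"
    using ineq[of t] unfolding tp by (simp add: power2_eq_square algebra_simps)
  then have "2 * (\<bar>r\<bar> + 1) \<le> r"
    using t0 by (simp add: mult_le_cancel_left)
  moreover have "r \<le> \<bar>r\<bar>" "0 \<le> \<bar>r\<bar>" by auto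
  ultimately show False by argo
qed

text \<open>The form attains its maximum on the unit sphere by compactness. Functions live on the
  whole type, so the coordinates outside \<open>V\<close> are pinned to 0 and the others confined to
  an interval, which makes \<open>C\<close> a product of compact sets.\<close>

lemma graph_index_exists:
  assumes "V \<noteq> {}"
  shows "\<exists>r. graph_index V E r"
proof -
  define C :: "('a \<Rightarrow> real) set" where
    "C = PiE UNIV (\<lambda>v. if v \<in> V then {-1..1} else {0})"
  define K where "K = C \<inter> {x. (\<Sum>v\<in>V. (x v)\<^sup>2) = 1}"
  have "compactin (product_topology (\<lambda>i. euclidean) UNIV) C"
    unfolding C_def by (subst compactin_PiE) auto
  then have C: "compact C"
    by (simp add: euclidean_product_topology)
  have coord: "continuous_on S (\<lambda>x. x v)" for S :: "('a \<Rightarrow> real) set" and v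
    by (rule continuous_on_subset[OF continuous_on_product_coordinates]) auto
  have "closed {x :: 'a \<Rightarrow> real. (\<Sum>v\<in>V. (x v)\<^sup>2) = 1}"
    by (intro closed_Collect_eq continuous_intros coord)
  then have K: "compact K"
    unfolding K_def using C by (rule compact_Int_closed[rotated])
  obtain w where w: "w \<in> V"
    using assms by auto
  have "(\<lambda>v. if v = w then 1 else 0) \<in> K"
    using w finite_V by (auto simp: K_def C_def if_distrib[of "\<lambda>t. t\<^sup>2"] cong: if_cong)
  then have K_ne: "K \<noteq> {}" by auto
  have cont: "continuous_on K (qform E)"
    unfolding qform_def case_prod_unfold by (intro continuous_intros coord)
  obtain x where x: "x \<in> K" and max: "\<And>y. y \<in> K \<Longrightarrow> qform E y \<le> qform E x"
    using continuous_attains_sup[OF K K_ne cont] by auto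
  define r where "r = qform E x"
  have le: "qform E y \<le> r * (\<Sum>v\<in>V. (y v)\<^sup>2)" for y
  proof (cases "(\<Sum>v\<in>V. (y v)\<^sup>2) = 0")
    case True
    then have "\<forall>v\<in>V. y v = 0"
      using finite_V by (simp add: sum_nonneg_eq_0_iff)
    then have "qform E y = 0"
      unfolding qform_eq by simp
    then show ?thesis using True by simp
  next
    case False
    define s where "s = sqrt (\<Sum>v\<in>V. (y v)\<^sup>2)"
    have s2: "s\<^sup>2 = (\<Sum>v\<in>V. (y v)\<^sup>2)"
      by (simp add: s_def sum_nonneg)
    have s: "s > 0"
      using False by (simp add: s_def sum_nonneg less_le)
    define z where "z = (\<lambda>v. if v \<in> V then y v / s else 0)"
    have nz: "(\<Sum>v\<in>V. (z v)\<^sup>2) = 1"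
    proof -
      have "(\<Sum>v\<in>V. (z v)\<^sup>2) = (\<Sum>v\<in>V. (y v)\<^sup>2 / s\<^sup>2)"
        by (intro sum.cong) (auto simp: z_def power_divide)
      also have "\<dots> = (\<Sum>v\<in>V. (y v)\<^sup>2) / s\<^sup>2"
        by (rule sum_divide_distrib[symmetric])
      also have "\<dots> = 1"
        unfolding s2[symmetric] using s by simp
      finally show ?thesis .
    qed
    have "-1 \<le> z v \<and> z v \<le> 1" if "v \<in> V" for v
    proof -
      have "(z v)\<^sup>2 \<le> (\<Sum>v\<in>V. (z v)\<^sup>2)"
        using that finite_V by (intro member_le_sum) auto
      then show ?thesis
        using nz abs_square_le_1[of "z v"] by (simp add: abs_le_iff)
    qed
    moreover have "z v = 0" if "v \<notin> V" for v
      using that by (simp add: z_def)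
    ultimately have "z \<in> C"
      unfolding C_def by (intro PiE_I) auto
    then have "z \<in> K"
      using nz by (simp add: K_def)
    then have "qform E z \<le> r"
      using max by (simp add: r_def)
    moreover have "qform E z = qform E y / s\<^sup>2"
    proof -
      have "qform E z = (\<Sum>(u, v)\<in>E. y u * y v / s\<^sup>2)"
        unfolding qform_def using edge_verts
        by (intro sum.cong) (auto simp: z_def power2_eq_square)
      then show ?thesis
        by (simp add: qform_def sum_divide_distrib case_prod_unfold)
    qed
    ultimately show ?thesis
      using s by (simp add: s2[symmetric] divide_le_eq)
  qed
  \<comment> \<open>Absolute values keep the norm and do not lower the form, so \<open>a\<close> is
    again a maximizer and hence a nonnegative eigenvector.\<close>
  define a where "a = (\<lambda>v. \<bar>x v\<bar>)"
  have na: "(\<Sum>v\<in>V. (a v)\<^sup>2) = 1"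
    using x by (simp add: a_def K_def)
  have "qform E x \<le> qform E a"
    unfolding qform_def a_def by (intro sum_mono) (auto simp: abs_mult[symmetric])
  then have "qform E a = r * (\<Sum>v\<in>V. (a v)\<^sup>2)"
    using le[of a] na by (simp add: r_def)
  then have "\<forall>u\<in>V. (\<Sum>v\<in>E `` {u}. a v) = r * a u"
    using maximizer_is_eigenvector[OF le] by auto
  moreover have "\<exists>v\<in>V. a v \<noteq> 0"
  proof (rule ccontr)
    assume "\<not> ?thesis"
    then have "(\<Sum>v\<in>V. (a v)\<^sup>2) = 0" by simp
    with na show False by simp
  qed
  ultimately have "graph_index V E r"
    unfolding graph_index_def using le by (intro conjI exI[of _ a]) (auto simp: a_def)
  then show ?thesis ..
qed

lemma eigenvalue_le_index:
  assumes "graph_index V E r" "\<forall>u\<in>V. (\<Sum>v\<in>E `` {u}. x v) = k * x u" "\<exists>v\<in>V. x v \<noteq> 0"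
  shows "k \<le> r"
proof -
  have "k * (\<Sum>v\<in>V. (x v)\<^sup>2) \<le> r * (\<Sum>v\<in>V. (x v)\<^sup>2)"
    using assms(1) unfolding graph_index_def qform_eigenvector[OF assms(2), symmetric] by blast
  moreover have "(\<Sum>v\<in>V. (x v)\<^sup>2) > 0"
    using assms(3) norm2_pos by blast
  ultimately show ?thesis
    by (simp add: mult_le_cancel_right)
qed

text \<open>
  The row of \<open>v\<close> in \<open>A\<^sup>2 - (c - 1) A\<close> sums to at most \<open>2m - c (n - 1)\<close>, and weighting the rows by a
  nonnegative eigenvector turns this into a bound for the eigenvalue.
\<close>

lemma index_degree_bound:
  assumes r: "graph_index V E r"
    and deg: "\<And>v. v \<in> V \<Longrightarrow> c \<le> card (E `` {v})"
  shows "r * (r - real c + 1) \<le> real (card E) - real c * (real (card V) - 1)"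
proof -
  obtain x where x0: "\<And>v. 0 \<le> x v" and xn: "\<exists>v\<in>V. x v \<noteq> 0"
    and ev: "\<And>u. u \<in> V \<Longrightarrow> (\<Sum>v\<in>E `` {u}. x v) = r * x u"
    using r unfolding graph_index_def by blast
  define d where "d = (\<lambda>v. real (card (E `` {v})))"
  define s where "s = (\<Sum>v\<in>V. x v)"
  have s: "s > 0"
  proof -
    obtain v where "v \<in> V" "x v \<noteq> 0" using xn by auto
    then show ?thesis
      unfolding s_def using x0 finite_V
      by (intro sum_pos2[where i = v]) (auto simp: less_le)
  qed
  have rs: "r * s = (\<Sum>v\<in>V. d v * x v)"
  proof -
    have "r * s = (\<Sum>u\<in>V. \<Sum>v\<in>E `` {u}. x v)"
      by (simp add: s_def sum_distrib_left ev)
    also have "\<dots> = (\<Sum>(u, v)\<in>E. x v)"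
      by (simp add: sum_over_edges)
    also have "\<dots> = (\<Sum>(u, v)\<in>E. x u)"
      by (rule sum_over_edges_swap)
    also have "\<dots> = (\<Sum>u\<in>V. d u * x u)"
      by (simp add: sum_over_edges d_def)
    finally show ?thesis .
  qed
  have rrs: "r * (r * s) = (\<Sum>v\<in>V. x v * (\<Sum>u\<in>E `` {v}. d u))"
  proof -
    have "r * (r * s) = (\<Sum>u\<in>V. d u * (r * x u))"
      unfolding rs by (simp add: sum_distrib_left mult_ac)
    also have "\<dots> = (\<Sum>u\<in>V. d u * (\<Sum>v\<in>E `` {u}. x v))"
      by (intro sum.cong) (auto simp: ev)
    also have "\<dots> = (\<Sum>(u, v)\<in>E. d u * x v)"
      by (simp add: sum_over_edges sum_distrib_left)
    also have "\<dots> = (\<Sum>(u, v)\<in>E. d v * x u)"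
      by (rule sum_over_edges_swap)
    also have "\<dots> = (\<Sum>v\<in>V. x v * (\<Sum>u\<in>E `` {v}. d u))"
      by (simp add: sum_over_edges sum_distrib_left mult_ac)
    finally show ?thesis .
  qed
  define b where "b = real (card E) - real c * (real (card V) - 1)"
  \<comment> \<open>The neighbours of \<open>v\<close> have total degree \<open>card E\<close> minus
    \<open>d v\<close> minus the degrees in \<open>?R\<close>, and \<open>?R\<close> consists of
    \<open>card V - 1 - d v\<close> vertices of degree at least \<open>c\<close>.\<close>
  have row: "(\<Sum>u\<in>E `` {v}. d u) - (real c - 1) * d v \<le> b" if v: "v \<in> V" for v
  proof -
    let ?N = "E `` {v}" and ?R = "V - E `` {v} - {v}"
    have vN: "v \<notin> ?N" using no_loop by auto
    have dE: "real (card E) = (\<Sum>u\<in>V. d u)"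
      by (simp add: handshake d_def)
    have "V = insert v (?N \<union> ?R)"
      using v nbrs_subset[of "{v}"] by auto
    then have "(\<Sum>u\<in>V. d u) = (\<Sum>u\<in>insert v (?N \<union> ?R). d u)"
      by simp
    also have "\<dots> = d v + ((\<Sum>u\<in>?N. d u) + (\<Sum>u\<in>?R. d u))"
      using vN finite_V finite_nbrs by (subst sum.insert) (auto intro!: sum.union_disjoint)
    finally have split: "real (card E) = d v + ((\<Sum>u\<in>?N. d u) + (\<Sum>u\<in>?R. d u))"
      using dE by simp
    have "(\<Sum>u\<in>?R. real c) \<le> (\<Sum>u\<in>?R. d u)"
      using deg by (intro sum_mono) (auto simp: d_def)
    moreover have "real (card ?R) = real (card V) - 1 - d v"
    proof -
      have "card V = Suc (card ?N + card ?R)"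
      proof -
        have "card (?N \<union> ?R) = card ?N + card ?R"
          using finite_V finite_nbrs by (intro card_Un_disjoint) auto
        moreover have "card (insert v (?N \<union> ?R)) = Suc (card (?N \<union> ?R))"
          using finite_V finite_nbrs vN by (intro card_insert_disjoint) auto
        ultimately show ?thesis
          using \<open>V = insert v (?N \<union> ?R)\<close> by simp
      qed
      then show ?thesis by (simp add: d_def)
    qed
    ultimately have "(real (card V) - 1 - d v) * real c \<le> (\<Sum>u\<in>?R. d u)"
      by (simp only: sum_constant)
    then show ?thesis
      unfolding b_def split by (simp add: algebra_simps)
  qed
  have "r * (r - real c + 1) * s = r * (r * s) - (real c - 1) * (r * s)"
    by (simp add: algebra_simps)
  also have "\<dots> = (\<Sum>v\<in>V. x v * ((\<Sum>u\<in>E `` {v}. d u) - (real c - 1) * d v))"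
    unfolding rrs unfolding rs
    by (simp add: sum_distrib_left sum_subtractf[symmetric] algebra_simps)
  also have "\<dots> \<le> (\<Sum>v\<in>V. x v * b)"
    using row x0 by (intro sum_mono mult_left_mono) auto
  also have "\<dots> = b * s"
    by (simp add: s_def sum_distrib_left mult_ac)
  finally show ?thesis
    using s unfolding b_def[symmetric] by (simp add: mult_le_cancel_right)
qed

end

section \<open>Comparing the indices of two graphs\<close>

lemma qform_mono:
  assumes "E \<subseteq> F" "finite F" "\<And>v. 0 \<le> x v"
  shows "qform E x \<le> qform F x"
  unfolding qform_def using assms by (intro sum_mono2) auto

lemma graph_index_mono:
  assumes E: "ugraph V E" and F: "ugraph V F" and "E \<subseteq> F"
    and r: "graph_index V E r" and s: "graph_index V F s"
  shows "r \<le> s"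
proof -
  interpret E: ugraph V E by fact
  interpret F: ugraph V F by fact
  obtain x where x: "\<And>v. 0 \<le> x v" "\<exists>v\<in>V. x v \<noteq> 0"
    and ev: "\<forall>u\<in>V. (\<Sum>v\<in>E `` {u}. x v) = r * x u"
    using r unfolding graph_index_def by blast
  have "r * (\<Sum>v\<in>V. (x v)\<^sup>2) = qform E x"
    using E.qform_eigenvector[OF ev] by simp
  also have "\<dots> \<le> qform F x"
    using qform_mono[OF \<open>E \<subseteq> F\<close> F.finite_E x(1)] .
  also have "\<dots> \<le> s * (\<Sum>v\<in>V. (x v)\<^sup>2)"
    using s unfolding graph_index_def by blast
  finally have "r * (\<Sum>v\<in>V. (x v)\<^sup>2) \<le> s * (\<Sum>v\<in>V. (x v)\<^sup>2)" .
  moreover have "(\<Sum>v\<in>V. (x v)\<^sup>2) > 0"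
    using x(2) E.norm2_pos by blast
  ultimately show ?thesis
    by (simp add: mult_le_cancel_right)
qed

text \<open>With equal indices, the nonnegative eigenvector of \<open>E\<close> also maximizes the
  form of \<open>F\<close>, so it is an eigenvector of \<open>F\<close>. Connectivity of
  \<open>F\<close> makes it positive everywhere, and then an additional arc would strictly increase
  the form.\<close>

lemma graph_index_strict_mono:
  assumes E: "ugraph V E" and F: "ugraph V F" and "E \<subseteq> F"
    and conn: "\<And>u v. u \<in> V \<Longrightarrow> v \<in> V \<Longrightarrow> (u, v) \<in> F\<^sup>*"
    and r: "graph_index V E r" and s: "graph_index V F s" and "s \<le> r"
  shows "E = F"
proof (rule ccontr)
  assume "E \<noteq> F"
  then obtain a b where ab: "(a, b) \<in> F" "(a, b) \<notin> E"
    using \<open>E \<subseteq> F\<close> by auto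
  interpret E: ugraph V E by fact
  interpret F: ugraph V F by fact
  have rs: "r = s"
    using graph_index_mono[OF E F \<open>E \<subseteq> F\<close> r s] \<open>s \<le> r\<close> by simp
  obtain x w where x: "\<And>v. 0 \<le> x v" and w: "w \<in> V" "x w \<noteq> 0"
    and ev: "\<forall>u\<in>V. (\<Sum>v\<in>E `` {u}. x v) = r * x u"
    using r unfolding graph_index_def by blast
  have le: "qform F y \<le> s * (\<Sum>v\<in>V. (y v)\<^sup>2)" for y
    using s unfolding graph_index_def by auto
  have qE: "qform E x = s * (\<Sum>v\<in>V. (x v)\<^sup>2)"
    using E.qform_eigenvector[OF ev] rs by simp
  have qF: "qform F x = s * (\<Sum>v\<in>V. (x v)\<^sup>2)"
    using qE le[of x] qform_mono[of E F x, OF \<open>E \<subseteq> F\<close> F.finite_E x] by simp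
  note evF = F.maximizer_is_eigenvector[OF le qF]
  have step: "x v \<noteq> 0" if "(u, v) \<in> F" "x u \<noteq> 0" for u v
  proof
    assume "x v = 0"
    moreover have "v \<in> V" using that F.edge_verts by auto
    ultimately have "(\<Sum>z\<in>F `` {v}. x z) = 0"
      using evF by simp
    then have "x u = 0"
      using that x F.finite_nbrs F.edge_sym by (subst (asm) sum_nonneg_eq_0_iff) auto
    with that show False by simp
  qed
  have "x v \<noteq> 0" if "(w, v) \<in> F\<^sup>*" for v
    using that by (induction rule: rtrancl_induct) (auto simp: w step)
  then have pos: "x v > 0" if "v \<in> V" for v
    using conn[OF w(1) that] x[of v] by (simp add: less_le)
  have "qform E x < qform F x"
    unfolding qform_def
    using ab F.edge_verts x pos F.finite_E \<open>E \<subseteq> F\<close>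
    by (intro sum_strict_mono2[where b = "(a, b)"]) auto
  then show False
    using qE qF by simp
qed

text \<open>The indicator of \<open>X\<close> has Rayleigh quotient \<open>card X - 1\<close>. If
  \<open>r\<close> were no larger, it would be a maximizer and so an eigenvector, which fails at
  \<open>w\<close>: its own value is 0, its neighbour sum is not.\<close>

lemma clique_index_gt:
  assumes E: "ugraph V E" and r: "graph_index V E r"
    and X: "X \<subseteq> V" "\<And>u v. u \<in> X \<Longrightarrow> v \<in> X \<Longrightarrow> u \<noteq> v \<Longrightarrow> (u, v) \<in> E"
    and w: "(w, a) \<in> E" "w \<notin> X" "a \<in> X"
  shows "real (card X) - 1 < r"
proof (rule ccontr)
  interpret ugraph V E by fact
  assume "\<not> ?thesis"
  then have rle: "r \<le> real (card X) - 1" by simp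
  define x where "x = (\<lambda>v. if v \<in> X then 1 else 0::real)"
  have finX: "finite X" using X(1) finite_V by (rule finite_subset)
  have nx: "(\<Sum>v\<in>V. (x v)\<^sup>2) = card X"
    using X(1) finite_V by (simp add: x_def if_distrib[of "\<lambda>t. t\<^sup>2"] sum.If_cases Int_absorb1 cong: if_cong)
  have "(\<Sum>v\<in>E `` {u}. x v) = real (card X) - 1" if "u \<in> X" for u
  proof -
    have "E `` {u} \<inter> X = X - {u}"
      using that X(2) no_loop by auto
    then show ?thesis
      using that finX card_gt_0_iff[of X] finite_nbrs
      by (auto simp: x_def sum.If_cases card_Diff_singleton of_nat_diff)
  qed
  then have "(\<Sum>u\<in>V. x u * (\<Sum>v\<in>E `` {u}. x v)) = (\<Sum>u\<in>V. if u \<in> X then real (card X) - 1 else 0)"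
    by (intro sum.cong) (auto simp: x_def)
  also have "\<dots> = (real (card X) - 1) * card X"
    using X(1) finite_V by (simp add: sum.If_cases Int_absorb1)
  finally have q: "qform E x = (real (card X) - 1) * (\<Sum>v\<in>V. (x v)\<^sup>2)"
    unfolding qform_eq nx .
  have le: "qform E y \<le> r * (\<Sum>v\<in>V. (y v)\<^sup>2)" for y
    using r unfolding graph_index_def by auto
  have "qform E x \<ge> r * (\<Sum>v\<in>V. (x v)\<^sup>2)"
    unfolding q using rle by (intro mult_right_mono) (auto simp: sum_nonneg)
  then have "qform E x = r * (\<Sum>v\<in>V. (x v)\<^sup>2)"
    using le[of x] by simp
  then have "(\<Sum>v\<in>E `` {w}. x v) = r * x w"
    using maximizer_is_eigenvector[OF le] w edge_verts by auto
  then have "(\<Sum>v\<in>E `` {w}. x v) = 0"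
    using w by (simp add: x_def)
  moreover have "x a \<le> (\<Sum>v\<in>E `` {w}. x v)"
    using w finite_nbrs by (intro member_le_sum) (auto simp: x_def)
  ultimately show False
    using w by (simp add: x_def)
qed

lemma graph_index_iso:
  assumes E: "ugraph V E" and bij: "bij_betw f U V"
    and F: "ugraph U F" and iso: "\<And>a b. a \<in> U \<Longrightarrow> b \<in> U \<Longrightarrow> (a, b) \<in> F \<longleftrightarrow> (f a, f b) \<in> E"
    and r: "graph_index V E r" and s: "graph_index U F s"
  shows "s \<le> r"
proof -
  interpret E: ugraph V E by fact
  interpret F: ugraph U F by fact
  define g where "g = the_inv_into U f"
  have inj: "inj_on f U" and im: "f ` U = V" using bij by (auto simp: bij_betw_def)
  have gf: "g (f a) = a" if "a \<in> U" for a
    using that inj by (simp add: g_def the_inv_into_f_f)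
  obtain x where x: "\<exists>v\<in>U. x v \<noteq> 0"
    and ev: "\<forall>u\<in>U. (\<Sum>v\<in>F `` {u}. x v) = s * x u"
    using s unfolding graph_index_def by blast
  have "(\<Sum>v\<in>E `` {u}. x (g v)) = s * x (g u)" if "u \<in> V" for u
  proof -
    obtain a where a: "a \<in> U" "u = f a" using \<open>u \<in> V\<close> im by auto
    have "E `` {u} = f ` (F `` {a})"
      using a iso E.edge_verts F.edge_verts im by (auto simp: image_iff) blast+
    moreover have "inj_on f (F `` {a})"
      using inj F.nbrs_subset by (rule inj_on_subset)
    ultimately have "(\<Sum>v\<in>E `` {u}. x (g v)) = (\<Sum>b\<in>F `` {a}. x (g (f b)))"
      by (simp add: sum.reindex)
    also have "\<dots> = (\<Sum>b\<in>F `` {a}. x b)"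
    proof (rule sum.cong)
      fix b assume "b \<in> F `` {a}"
      then have "b \<in> U" using F.nbrs_subset by blast
      then show "x (g (f b)) = x b" by (simp add: gf)
    qed simp
    finally show ?thesis
      using ev a gf by simp
  qed
  moreover have "\<exists>v\<in>V. x (g v) \<noteq> 0"
    using x im gf by auto
  ultimately show ?thesis
    using E.eigenvalue_le_index[OF r, of "\<lambda>v. x (g v)" s] by blast
qed

section \<open>Hamiltonian cycles and degree sums\<close>

lemma successively_iff_nth:
  "successively P xs \<longleftrightarrow> (\<forall>i. Suc i < length xs \<longrightarrow> P (xs ! i) (xs ! Suc i))"
proof (induction xs rule: induct_list012)
  case (3 x y xs)
  then show ?case
    by (auto simp: nth_Cons split: nat.splits)
qed auto

definition hamiltonian :: "'a set \<Rightarrow> ('a \<times> 'a) set \<Rightarrow> bool" where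
  "hamiltonian V E \<longleftrightarrow> (\<exists>vs. distinct vs \<and> set vs = V \<and> 3 \<le> length vs \<and>
     successively (\<lambda>u v. (u, v) \<in> E) (vs @ [hd vs]))"

text \<open>
  A labelling \<open>f\<close> that is constant along the edges avoiding \<open>S\<close> is constant on the components of
  \<open>G - S\<close>; the best labelling has exactly one label per component.
\<close>

definition one_tough :: "'a set \<Rightarrow> ('a \<times> 'a) set \<Rightarrow> bool" where
  "one_tough V E \<longleftrightarrow> (\<forall>S\<subseteq>V. \<forall>f :: 'a \<Rightarrow> nat.
     (\<forall>u v. (u, v) \<in> E \<longrightarrow> u \<notin> S \<longrightarrow> v \<notin> S \<longrightarrow> f u = f v) \<longrightarrow>
     1 < card (f ` (V - S)) \<longrightarrow> card (f ` (V - S)) \<le> card S)"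

text \<open>The graph equals its Bondy-Chvatal closure: no nonadjacent pair reaches degree sum
  \<open>card V\<close>.\<close>

definition ore_closed :: "'a set \<Rightarrow> ('a \<times> 'a) set \<Rightarrow> bool" where
  "ore_closed V E \<longleftrightarrow> (\<forall>u\<in>V. \<forall>v\<in>V. u \<noteq> v \<longrightarrow> (u, v) \<notin> E \<longrightarrow>
     card (E `` {u}) + card (E `` {v}) < card V)"

lemma one_tough_mono: "one_tough V E \<Longrightarrow> E \<subseteq> F \<Longrightarrow> one_tough V F"
  unfolding one_tough_def by (meson subsetD)

context ugraph
begin

text \<open>Crossing argument: \<open>A\<close> holds the positions just before neighbours of
  \<open>u\<close>, \<open>B\<close> those of neighbours of \<open>v\<close>. Both lie among the
  first \<open>n - 1\<close> positions, and a common position would close the path to a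
  cycle.\<close>

lemma hamiltonian_path_degree_sum:
  assumes vs: "distinct vs" "set vs = V" "3 \<le> length vs"
    and path: "successively (\<lambda>u v. (u, v) \<in> E) vs"
    and ends: "hd vs = u" "last vs = v"
    and non_ham: "\<not> hamiltonian V E"
  shows "card (E `` {u}) + card (E `` {v}) < card V"
proof -
  define n where "n = length vs"
  have n: "n = card V" "3 \<le> n"
    using distinct_card[OF vs(1)] vs(2,3) by (auto simp: n_def)
  have ne: "vs \<noteq> []" using vs(3) by auto
  have u0: "u = vs ! 0" and vn: "v = vs ! (n - 1)"
    using ends ne by (auto simp: hd_conv_nth last_conv_nth n_def)
  define A where "A = {i. i < n - 1 \<and> (u, vs ! Suc i) \<in> E}"
  define B where "B = {i. i < n - 1 \<and> (vs ! i, v) \<in> E}"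
  have inj: "i = j" if "vs ! i = vs ! j" "i < n" "j < n" for i j
    using that vs(1) by (simp add: nth_eq_iff_index_eq n_def)
  have "E `` {u} \<subseteq> (\<lambda>i. vs ! Suc i) ` A"
  proof
    fix w assume w: "w \<in> E `` {u}"
    then have "w \<in> set vs" using vs(2) nbrs_subset by blast
    then obtain i where i: "i < n" "w = vs ! i"
      by (auto simp: in_set_conv_nth n_def)
    have "i \<noteq> 0" using w i u0 no_loop by (metis Image_singleton_iff)
    then obtain j where "i = Suc j" by (cases i) auto
    then show "w \<in> (\<lambda>i. vs ! Suc i) ` A"
      using w i by (auto simp: A_def)
  qed
  then have A: "card (E `` {u}) \<le> card A"
    by (rule surj_card_le[rotated]) (simp add: A_def)
  have "E `` {v} \<subseteq> (\<lambda>i. vs ! i) ` B"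
  proof
    fix w assume w: "w \<in> E `` {v}"
    then have "w \<in> set vs" using vs(2) nbrs_subset by blast
    then obtain i where i: "i < n" "w = vs ! i"
      by (auto simp: in_set_conv_nth n_def)
    have "i \<noteq> n - 1" using w i vn no_loop by (metis Image_singleton_iff)
    then show "w \<in> (\<lambda>i. vs ! i) ` B"
      using w i edge_sym by (auto simp: B_def)
  qed
  then have B: "card (E `` {v}) \<le> card B"
    by (rule surj_card_le[rotated]) (simp add: B_def)
  have "A \<inter> B = {}"
  proof (rule ccontr)
    assume "A \<inter> B \<noteq> {}"
    then obtain i where i: "i < n - 1" "(u, vs ! Suc i) \<in> E" "(vs ! i, v) \<in> E"
      by (auto simp: A_def B_def)
    \<comment> \<open>The cycle runs from \<open>u\<close> to \<open>vs ! i\<close>, jumps to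
      \<open>v\<close>, goes backwards to \<open>vs ! Suc i\<close> and returns to
      \<open>u\<close>.\<close>
    define xs where "xs = take (Suc i) vs"
    define ys where "ys = drop (Suc i) vs"
    have vs_eq: "vs = xs @ ys" by (simp add: xs_def ys_def)
    have xy: "xs \<noteq> []" "ys \<noteq> []"
      using ne i(1) by (auto simp: xs_def ys_def n_def)
    have "hd xs = u" using vs_eq xy ends by simp
    moreover have "last ys = v" using vs_eq xy ends by simp
    moreover have "hd ys = vs ! Suc i"
      using i(1) by (simp add: ys_def hd_drop_conv_nth n_def)
    moreover have "last xs = vs ! i"
      using i(1) by (simp add: xs_def take_Suc_conv_app_nth n_def)
    moreover have "successively (\<lambda>u v. (u, v) \<in> E) xs" "successively (\<lambda>u v. (u, v) \<in> E) ys"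
      using path unfolding vs_eq by (auto simp: successively_append_iff)
    ultimately have "successively (\<lambda>u v. (u, v) \<in> E) ((xs @ rev ys) @ [hd (xs @ rev ys)])"
      using i xy edge_sym
      by (simp add: successively_append_iff hd_rev last_rev)
    moreover have "distinct (xs @ rev ys)" "set (xs @ rev ys) = V" "3 \<le> length (xs @ rev ys)"
      using vs unfolding vs_eq by auto
    ultimately have "hamiltonian V E"
      unfolding hamiltonian_def by blast
    with non_ham show False ..
  qed
  then have "card A + card B = card (A \<union> B)"
    by (intro card_Un_disjoint[symmetric]) (auto simp: A_def B_def)
  also have "\<dots> \<le> card {..<n - 1}"
    by (intro card_mono) (auto simp: A_def B_def)
  finally show ?thesis using A B n by simp
qed

text \<open>A hamiltonian cycle of the enlarged graph must use the new edge; rotated so that this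
  edge closes the cycle, it leaves a hamiltonian path of \<open>E\<close> between \<open>u\<close>
  and \<open>v\<close>.\<close>

lemma non_edge_degree_sum:
  assumes non_ham: "\<not> hamiltonian V E"
    and ham: "hamiltonian V (E \<union> {(u, v), (v, u)})"
  shows "card (E `` {u}) + card (E `` {v}) < card V"
proof -
  define F where "F = E \<union> {(u, v), (v, u)}"
  obtain vs where vs: "distinct vs" "set vs = V" "3 \<le> length vs"
    and cyc: "successively (\<lambda>u v. (u, v) \<in> F) (vs @ [hd vs])"
    using ham unfolding hamiltonian_def F_def by blast
  define n where "n = length vs"
  have ne: "vs \<noteq> []" using vs(3) by auto
  have "\<not> successively (\<lambda>u v. (u, v) \<in> E) (vs @ [hd vs])"
    using vs non_ham unfolding hamiltonian_def by blast
  then obtain i where i: "i < n" "((vs @ [hd vs]) ! i, (vs @ [hd vs]) ! Suc i) \<notin> E"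
    by (auto simp: successively_iff_nth n_def)
  have iF: "((vs @ [hd vs]) ! i, (vs @ [hd vs]) ! Suc i) \<in> F"
    using cyc i(1) by (auto simp: successively_iff_nth n_def)
  define xs where "xs = take (Suc i) vs"
  define ys where "ys = drop (Suc i) vs"
  define zs where "zs = ys @ xs"
  have vs_eq: "vs = xs @ ys" by (simp add: xs_def ys_def)
  have xs: "xs \<noteq> []" using ne by (simp add: xs_def)
  have last_xs: "last xs = vs ! i"
    using i(1) by (simp add: xs_def take_Suc_conv_app_nth n_def)
  have last_zs: "last zs = (vs @ [hd vs]) ! i"
    using xs last_xs i(1) by (simp add: zs_def nth_append n_def)
  have hd_zs: "hd zs = (vs @ [hd vs]) ! Suc i"
  proof (cases "Suc i < n")
    case True
    then show ?thesis
      by (simp add: zs_def ys_def hd_append hd_drop_conv_nth nth_append n_def)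
  next
    case False
    then have "Suc i = n" using i(1) by simp
    then show ?thesis
      by (simp add: zs_def ys_def xs_def nth_append n_def)
  qed
  have zs: "distinct zs" "set zs = V" "length zs = n"
    using vs unfolding vs_eq zs_def n_def by auto
  have zF: "successively (\<lambda>u v. (u, v) \<in> F) zs"
    using cyc xs unfolding vs_eq zs_def by (auto simp: successively_append_iff)
  have ends: "(last zs, hd zs) = (u, v) \<or> (last zs, hd zs) = (v, u)"
    using i(2) iF unfolding last_zs hd_zs F_def by blast
  have zs_ne: "zs \<noteq> []" using xs by (simp add: zs_def)
  \<comment> \<open>The new edge joins positions 0 and \<open>n - 1\<close> of \<open>zs\<close>,
    which are not consecutive because \<open>n\<close> is at least 3.\<close>
  have "(zs ! j, zs ! Suc j) \<in> E" if j: "Suc j < n" for j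
  proof -
    have jF: "(zs ! j, zs ! Suc j) \<in> F"
      using zF j zs(3) by (auto simp: successively_iff_nth)
    have "zs ! j \<noteq> zs ! (n - 1)"
      using j zs by (simp add: nth_eq_iff_index_eq)
    moreover have "zs ! Suc j \<noteq> zs ! (n - 1)" if "zs ! j = zs ! 0"
    proof -
      have "j = 0" using that j zs by (simp add: nth_eq_iff_index_eq)
      then show ?thesis using j zs vs(3) by (simp add: nth_eq_iff_index_eq n_def)
    qed
    ultimately show ?thesis
      using jF ends zs_ne zs(3) unfolding F_def by (auto simp: hd_conv_nth last_conv_nth)
  qed
  then have zE: "successively (\<lambda>u v. (u, v) \<in> E) zs"
    using zs(3) by (simp add: successively_iff_nth)
  show ?thesis
    using hamiltonian_path_degree_sum[OF zs(1,2) _ zE refl refl non_ham] zs(3) vs(3) ends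
    by (auto simp: n_def)
qed

lemma closed_extension:
  assumes "\<not> hamiltonian V E"
  obtains F where "E \<subseteq> F" "ugraph V F" "\<not> hamiltonian V F" "ore_closed V F"
proof -
  define P where "P = {F. E \<subseteq> F \<and> ugraph V F \<and> \<not> hamiltonian V F}"
  have "P \<subseteq> Pow (V \<times> V)"
    unfolding P_def using ugraph.edge_verts by blast
  then have "finite P"
    by (rule finite_subset) (simp add: finite_V)
  moreover have "E \<in> P"
    using assms ugraph_axioms by (simp add: P_def)
  ultimately obtain F where FP: "F \<in> P" and max: "\<And>F'. F' \<in> P \<Longrightarrow> F \<subseteq> F' \<Longrightarrow> F = F'"
    using finite_has_maximal2[of P E] by blast
  have F: "E \<subseteq> F" "ugraph V F" "\<not> hamiltonian V F"
    using FP by (auto simp: P_def)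
  interpret F: ugraph V F by (rule F)
  have "card (F `` {u}) + card (F `` {v}) < card V"
    if uv: "u \<in> V" "v \<in> V" "u \<noteq> v" "(u, v) \<notin> F" for u v
  proof (rule F.non_edge_degree_sum)
    let ?F = "F \<union> {(u, v), (v, u)}"
    have "ugraph V ?F"
    proof
      show "sym ?F" using F.sym_E by (auto simp: sym_def)
      show "irrefl ?F" using F.irrefl_E uv by (auto simp: irrefl_def)
    qed (use uv F.edge_verts finite_V in auto)
    then show "hamiltonian V ?F"
      using max[of ?F] F(1) uv unfolding P_def by blast
  qed (use F in simp)
  then show thesis
    using that F unfolding ore_closed_def by blast
qed

end

section \<open>A clique missing three vertices\<close>

text \<open>
  Without the summand \<open>k - 4\<close>, which a vertex of degree at most 4 provides, the first count would have
  the solutions \<open>(n, k) = (18, 8)\<close> and \<open>(n, k) = (19, 9)\<close>.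
\<close>

lemma degree_count_small_min:
  fixes n k t :: int
  assumes "18 \<le> n" "4 \<le> k" "2 * k < n"
    and "n * n - 7 * n + 20 \<le> t"
    and "t \<le> n * (n - 1 - k) + k * k - k * (n - 1 - 2 * k) - (k - 4)"
  shows False
proof -
  \<comment> \<open>The slack in \<open>2 * k < n\<close>. In terms of \<open>j\<close> the count is
    linear with nonnegative coefficient, so large \<open>k\<close> are excluded by the quadratic in
    \<open>k\<close> and the finitely many others by \<open>18 \<le> n\<close>.\<close>
  define j where "j = n - 2 * k - 1"
  have n: "n = 2 * k + 1 + j" and j: "0 \<le> j" using assms by (auto simp: j_def)
  have ineq: "k * k - 10 * k + 10 + (2 * k - 6) * j \<le> 0"
    using assms(4,5) unfolding n by (simp add: algebra_simps)
  show False
  proof (cases "10 \<le> k")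
    case True
    then have "k * 10 \<le> k * k" "0 \<le> (2 * k - 6) * j" using j by (auto intro: mult_left_mono)
    then show False using ineq by linarith
  next
    case False
    then have "k = 4 \<or> k = 5 \<or> k = 6 \<or> k = 7 \<or> k = 8 \<or> k = 9" using assms by auto
    then show False using ineq n j assms(1) by (elim disjE) auto
  qed
qed

text \<open>Minimum degree 5 provides no vertex to save \<open>k - 4\<close> on, but the better arc
  bound makes up for it.\<close>

lemma degree_count_large_min:
  fixes n k t :: int
  assumes "18 \<le> n" "4 \<le> k" "2 * k < n"
    and "n * n - 7 * n + 28 \<le> t"
    and "t \<le> n * (n - 1 - k) + k * k - k * (n - 1 - 2 * k)"
  shows False
proof -
  define j where "j = n - 2 * k - 1"
  have n: "n = 2 * k + 1 + j" and j: "0 \<le> j" using assms by (auto simp: j_def)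
  have ineq: "k * k - 11 * k + 22 + (2 * k - 6) * j \<le> 0"
    using assms(4,5) unfolding n by (simp add: algebra_simps)
  show False
  proof (cases "11 \<le> k")
    case True
    then have "k * 11 \<le> k * k" "0 \<le> (2 * k - 6) * j" using j by (auto intro: mult_left_mono)
    then show False using ineq by linarith
  next
    case False
    then have "k = 4 \<or> k = 5 \<or> k = 6 \<or> k = 7 \<or> k = 8 \<or> k = 9 \<or> k = 10" using assms by auto
    then show False using ineq n j assms(1) by (elim disjE) auto
  qed
qed

context ugraph
begin

definition deg :: "'a \<Rightarrow> nat" where
  "deg v = card (E `` {v})"

lemma deg_less: "v \<in> V \<Longrightarrow> deg v < card V"
  unfolding deg_def using no_loop nbrs_subset[of "{v}"] finite_V
  by (intro psubset_card_mono) auto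

lemma card_le_deg: "A \<subseteq> E `` {v} \<Longrightarrow> card A \<le> deg v"
  unfolding deg_def by (intro card_mono finite_nbrs)

definition nonadj_pair :: "nat \<Rightarrow> 'a \<Rightarrow> 'a \<Rightarrow> bool" where
  "nonadj_pair k x y \<longleftrightarrow> x \<in> V \<and> y \<in> V \<and> x \<noteq> y \<and> (x, y) \<notin> E \<and> k \<le> deg x \<and> k \<le> deg y"

lemma nonadj_pair_sym: "nonadj_pair k x y \<Longrightarrow> nonadj_pair k y x"
  unfolding nonadj_pair_def using edge_sym by blast

end

text \<open>
  The constants come from \<open>index_degree_bound\<close> with \<open>r > n - 4\<close>: \<open>c = 2\<close> gives more than
  \<open>n\<^sup>2 - 7 n + 18\<close> arcs, hence two more by parity, and \<open>c = 5\<close> gives more than \<open>n\<^sup>2 - 7 n + 27\<close>.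
\<close>

locale closed_dense_graph = ugraph +
  assumes closed: "ore_closed V E"
    and order: "18 \<le> card V"
    and dense: "card V * card V + 20 \<le> card E + 7 * card V"
    and dense5: "(\<And>v. v \<in> V \<Longrightarrow> 5 \<le> card (E `` {v})) \<Longrightarrow>
      card V * card V + 28 \<le> card E + 7 * card V"
begin

lemma closedD: "nonadj_pair k x y \<Longrightarrow> deg x + deg y < card V"
  using closed unfolding ore_closed_def nonadj_pair_def deg_def by blast

text \<open>
  For the largest \<open>k\<close> with a nonadjacent pair of degrees at least \<open>k\<close>, closedness yields \<open>k\<close> vertices of
  degree at most \<open>k\<close> and allows at most \<open>k\<close> vertices of degree at least \<open>n - k\<close>, as in Chvatal's degree
  condition. For \<open>k \<ge> 4\<close> this leaves too few edges.
\<close>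

lemma no_nonadj_pair_4: "\<not> nonadj_pair 4 x y"
proof
  assume "nonadj_pair 4 x y"
  then have ex4: "\<exists>x y. nonadj_pair 4 x y" by blast
  define n where "n = card V"
  have bound: "k \<le> n" if "\<exists>x y. nonadj_pair k x y" for k
    using that deg_less unfolding nonadj_pair_def n_def by (meson le_trans less_imp_le)
  define k where "k = (GREATEST k. \<exists>x y. nonadj_pair k x y)"
  have k_ex: "\<exists>x y. nonadj_pair k x y"
    unfolding k_def using ex4 bound by (rule GreatestI_nat)
  have k4: "4 \<le> k"
    unfolding k_def using ex4 bound by (rule Greatest_le_nat)
  have kmax: "\<not> nonadj_pair (Suc k) x y" for x y
  proof
    assume "nonadj_pair (Suc k) x y"
    then have "\<exists>x y. nonadj_pair (Suc k) x y" by blast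
    then have "Suc k \<le> k"
      unfolding k_def using bound by (rule Greatest_le_nat)
    then show False by simp
  qed
  obtain x y where xy: "nonadj_pair k x y" and dx: "deg x = k"
  proof -
    obtain x y where "nonadj_pair k x y" using k_ex by blast
    moreover then have "deg x = k \<or> deg y = k"
      using kmax[of x y] unfolding nonadj_pair_def by auto
    ultimately show thesis
      using that nonadj_pair_sym by blast
  qed
  have k2: "2 * k < n"
    using closedD[OF xy] xy unfolding nonadj_pair_def n_def by simp
  define L where "L = {v \<in> V. deg v \<le> k}"
  define U where "U = {v \<in> V. n \<le> deg v + k}"
  have high_clique: "(u, v) \<in> E" if "u \<in> V - L" "v \<in> V - L" "u \<noteq> v" for u v
    using that kmax[of u v] unfolding nonadj_pair_def L_def by auto
  \<comment> \<open>A vertex of \<open>U\<close> missed by \<open>x\<close> would have degree sum at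
    least \<open>n\<close> with \<open>x\<close>, whose degree is \<open>k\<close>.\<close>
  have "U \<subseteq> E `` {x}"
  proof
    fix u assume u: "u \<in> U"
    show "u \<in> E `` {x}"
    proof (rule ccontr)
      assume "u \<notin> E `` {x}"
      moreover have "u \<noteq> x" using u dx k2 by (auto simp: U_def)
      ultimately have "nonadj_pair 0 x u"
        using u xy by (auto simp: nonadj_pair_def U_def)
      then show False using closedD u dx by (fastforce simp: U_def n_def)
    qed
  qed
  then have U: "card U \<le> k"
    using card_le_deg dx by metis
  \<comment> \<open>If \<open>deg y > k\<close>, maximality of \<open>k\<close> puts all
    non-neighbours of \<open>y\<close> into \<open>L\<close>, and closedness makes them at least
    \<open>k\<close>. If \<open>deg y = k\<close> and \<open>L\<close> were smaller, the clique
    \<open>V - L\<close> would have all its vertices in \<open>U\<close>, too many since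
    \<open>2 * k < n\<close>.\<close>
  have L: "k \<le> card L"
  proof (cases "deg y = k")
    case False
    have "V - insert y (E `` {y}) \<subseteq> L"
    proof
      fix z assume "z \<in> V - insert y (E `` {y})"
      then show "z \<in> L"
        using False xy kmax[of y z] unfolding nonadj_pair_def L_def by auto
    qed
    then have "card (V - insert y (E `` {y})) \<le> card L"
      by (intro card_mono) (auto simp: L_def finite_V)
    moreover have "card (V - insert y (E `` {y})) = n - Suc (deg y)"
    proof -
      have "insert y (E `` {y}) \<subseteq> V"
        using xy nbrs_subset[of "{y}"] by (auto simp: nonadj_pair_def)
      moreover have "card (insert y (E `` {y})) = Suc (deg y)"
        using no_loop finite_nbrs by (simp add: deg_def)
      ultimately show ?thesis
        using finite_V finite_nbrs
        by (metis card_Diff_subset finite_insert n_def)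
    qed
    ultimately show ?thesis
      using closedD[OF xy] dx unfolding n_def by linarith
  next
    case True
    show ?thesis
    proof (rule ccontr)
      assume l: "\<not> k \<le> card L"
      have cVL: "card (V - L) = n - card L"
        using finite_V card_Diff_subset[of L V] by (simp add: L_def n_def)
      have "V - L \<subseteq> U"
      proof
        fix z assume z: "z \<in> V - L"
        have "card (V - L - {z}) \<le> deg z"
          using high_clique[OF z] by (intro card_le_deg) auto
        then have "n - card L - 1 \<le> deg z"
          using z cVL by simp
        then show "z \<in> U" using z l k2 by (auto simp: U_def)
      qed
      then have "card (V - L) \<le> card U"
        by (intro card_mono) (auto simp: U_def finite_V)
      then show False using U l k2 cVL by linarith
    qed
  qed
  obtain L' where L': "L' \<subseteq> L" "card L' = k"
    using L obtain_subset_with_card_n by metis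
  \<comment> \<open>A degree bound: \<open>n - 1\<close> on \<open>U\<close>, \<open>k\<close> on
    \<open>L'\<close>, and \<open>n - 1 - k\<close> elsewhere. Exactly \<open>k\<close> vertices are
    taken from \<open>L\<close> to make the sum explicit.\<close>
  define b :: "'a \<Rightarrow> int" where
    "b = (\<lambda>v. (int n - 1 - k) + (if v \<in> U then int k else 0) - (if v \<in> L' then int n - 1 - 2 * int k else 0))"
  have UL: "u \<notin> U" if "u \<in> L" for u
    using that k2 by (auto simp: L_def U_def)
  have db: "int (deg v) \<le> b v" if "v \<in> V" for v
    using that L'(1) UL[of v] deg_less[OF that] unfolding b_def
    by (auto simp: U_def L_def n_def)
  have sumb: "(\<Sum>v\<in>V. b v) \<le>
      int n * (int n - 1 - int k) + int k * int k - int k * (int n - 1 - 2 * int k)"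
  proof -
    have "U \<subseteq> V" "L' \<subseteq> V" using L' by (auto simp: U_def L_def)
    then have "(\<Sum>v\<in>V. b v) =
        int n * (int n - 1 - int k) + int (card U) * int k - int k * (int n - 1 - 2 * int k)"
      unfolding b_def using finite_V L'(2)
      by (simp add: sum.distrib sum_subtractf sum.If_cases Int_absorb1 n_def)
    moreover have "int (card U) * int k \<le> int k * int k"
      using U by (intro mult_right_mono) auto
    ultimately show ?thesis by linarith
  qed
  have cE: "int (card E) = (\<Sum>v\<in>V. int (deg v))"
    by (simp add: handshake deg_def)
  show False
  proof (cases "\<forall>v\<in>V. 5 \<le> deg v")
    case True
    then have "n * n + 28 \<le> card E + 7 * n"
      using dense5 unfolding deg_def n_def by blast
    then have "int n * int n + 28 \<le> card E + 7 * int n"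
      by (metis (mono_tags) of_nat_add of_nat_le_iff of_nat_mult of_nat_numeral)
    moreover have "int (card E) \<le> (\<Sum>v\<in>V. b v)"
      unfolding cE using db by (rule sum_mono)
    ultimately show False
      using sumb order k4 k2 unfolding n_def[symmetric]
      by (intro degree_count_large_min[of "int n" "int k" "int (card E)"]) linarith+
  next
    case False
    then obtain v0 where v0: "v0 \<in> V" "deg v0 \<le> 4" by force
    \<comment> \<open>The bound \<open>b\<close> allots at least \<open>k\<close> to
      \<open>v0\<close>, whose degree is at most 4; this is the saving of
      \<open>k - 4\<close>.\<close>
    have bv0: "int k \<le> b v0"
      using v0 k2 k4 L'(1) UL[of v0] unfolding b_def U_def by auto
    have "int (card E) = deg v0 + (\<Sum>v\<in>V - {v0}. int (deg v))"
      unfolding cE using v0 finite_V by (simp add: sum.remove)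
    also have "\<dots> \<le> 4 + (\<Sum>v\<in>V - {v0}. b v)"
      using v0 db by (intro add_mono sum_mono) auto
    also have "\<dots> = 4 + ((\<Sum>v\<in>V. b v) - b v0)"
      using v0 finite_V by (simp add: sum.remove)
    finally have "int (card E) \<le> (\<Sum>v\<in>V. b v) - (int k - 4)"
      using bv0 by linarith
    moreover have "int n * int n + 20 \<le> card E + 7 * int n"
      using dense unfolding n_def
      by (metis (mono_tags) of_nat_add of_nat_le_iff of_nat_mult of_nat_numeral)
    ultimately show False
      using sumb order k4 k2 unfolding n_def[symmetric]
      by (intro degree_count_small_min[of "int n" "int k" "int (card E)"]) linarith+
  qed
qed

text \<open>Four vertices of degree at most 3 meet at most 24 arcs, and the others span at most
  \<open>(n - 4) * (n - 5)\<close>. The sum stays below the arc bound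
  \<open>n * n - 7 * n + 20\<close> as soon as \<open>n > 12\<close>.\<close>

lemma few_low_degree: "card {v \<in> V. deg v \<le> 3} \<le> 3"
proof (rule ccontr)
  define n where "n = card V"
  assume "\<not> ?thesis"
  then obtain S where S: "S \<subseteq> {v \<in> V. deg v \<le> 3}" "card S = 4" "finite S"
    using obtain_subset_with_card_n[of 4 "{v \<in> V. deg v \<le> 3}"] by auto
  let ?A = "SIGMA s:S. E `` {s}" and ?B = "SIGMA v:V - S. (E `` {v}) - S"
  have fA: "finite ?A" and fB: "finite ?B"
    using S(3) finite_nbrs finite_V by auto
  have "E \<subseteq> ?A \<union> ?A\<inverse> \<union> ?B"
    using edge_verts edge_sym by auto
  then have "card E \<le> card (?A \<union> ?A\<inverse> \<union> ?B)"
    using fA fB by (intro card_mono) auto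
  also have "\<dots> \<le> card ?A + card (?A\<inverse>) + card ?B"
    by (meson add_le_cancel_right card_Un_le le_trans)
  finally have E: "card E \<le> 2 * card ?A + card ?B"
    by (simp add: card_inverse)
  have "card ?A = (\<Sum>s\<in>S. deg s)"
    using S(3) finite_nbrs by (simp add: deg_def)
  also have "\<dots> \<le> (\<Sum>s\<in>S. 3)"
    using S by (intro sum_mono) auto
  finally have A: "card ?A \<le> 12" using S by simp
  have cVS: "card (V - S) = n - 4"
    using S card_Diff_subset[of S V] by (auto simp: n_def)
  have "card ?B = (\<Sum>v\<in>V - S. card ((E `` {v}) - S))"
    using finite_V finite_nbrs by simp
  also have "\<dots> \<le> (\<Sum>v\<in>V - S. n - 5)"
  proof (rule sum_mono)
    fix v assume v: "v \<in> V - S"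
    have "card (E `` {v} - S) \<le> card (V - S - {v})"
      using no_loop nbrs_subset[of "{v}"] finite_V by (intro card_mono) auto
    then show "card (E `` {v} - S) \<le> n - 5"
      using v cVS by simp
  qed
  finally have B: "card ?B \<le> (n - 4) * (n - 5)" using cVS by simp
  have "n * n + 20 \<le> card E + 7 * n" "18 \<le> n" using dense order by (auto simp: n_def)
  moreover obtain m where "n = 5 + m"
    using le_Suc_ex[of 5 n] \<open>18 \<le> n\<close> by auto
  ultimately show False
    using E A B by (simp add: algebra_simps)
qed

lemma large_clique:
  obtains X where "X \<subseteq> V" "card (V - X) = 3" "\<And>u v. u \<in> X \<Longrightarrow> v \<in> X \<Longrightarrow> u \<noteq> v \<Longrightarrow> (u, v) \<in> E"
proof -
  let ?S = "{v \<in> V. deg v \<le> 3}"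
  \<comment> \<open>Padding to exactly three vertices; any two vertices outside \<open>W\<close>
    have degree at least 4, so they are adjacent.\<close>
  obtain W where W: "?S \<subseteq> W" "W \<subseteq> V" "card W = 3"
    using exists_subset_between[of ?S 3 V] few_low_degree order finite_V by auto
  have "(u, v) \<in> E" if "u \<in> V - W" "v \<in> V - W" "u \<noteq> v" for u v
    using that W(1) no_nonadj_pair_4[of u v] unfolding nonadj_pair_def by fastforce
  moreover have "V - (V - W) = W" using W(2) by auto
  ultimately show thesis
    using that[of "V - W"] W(3) by auto
qed

end

section \<open>Three vertices outside a clique\<close>

locale tough_clique_graph = ugraph +
  fixes X :: "'a set"
  assumes closed: "ore_closed V E"
    and tough: "one_tough V E"
    and min_deg: "v \<in> V \<Longrightarrow> 2 \<le> card (E `` {v})"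
    and non_ham: "\<not> hamiltonian V E"
    and X_subset: "X \<subseteq> V"
    and clique: "u \<in> X \<Longrightarrow> v \<in> X \<Longrightarrow> u \<noteq> v \<Longrightarrow> (u, v) \<in> E"
    and card_X: "5 \<le> card X"
    and card_outside: "card (V - X) = 3"
begin

definition N :: "'a \<Rightarrow> 'a set" where
  "N w = E `` {w} \<inter> X"

lemma N_iff: "x \<in> N w \<longleftrightarrow> (w, x) \<in> E \<and> x \<in> X"
  by (auto simp: N_def)

lemma finite_X: "finite X"
  using X_subset finite_V by (rule finite_subset)

lemma finite_N: "finite (N w)"
  using finite_X by (simp add: N_def)

lemma card_V: "card V = card X + 3"
  using card_outside card_Diff_subset[OF finite_X X_subset] card_mono[OF finite_V X_subset] by linarith

lemma successively_clique:
  assumes "distinct xs" "set xs \<subseteq> X"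
  shows "successively (\<lambda>u v. (u, v) \<in> E) xs"
  using assms clique by (intro successively_if_sorted_wrt) (induction xs, auto)

text \<open>All vertices missed by the path lie in the clique, so they can be strung in any order
  from its last vertex back to its first.\<close>

lemma no_path_through_outside:
  assumes xs: "distinct xs" "set xs \<subseteq> V" "V - X \<subseteq> set xs" "xs \<noteq> []"
    and ends: "hd xs \<in> X" "last xs \<in> X"
    and path: "successively (\<lambda>u v. (u, v) \<in> E) xs"
  shows False
proof -
  obtain ys where ys: "set ys = V - set xs" "distinct ys"
    using finite_distinct_list[of "V - set xs"] finite_V by auto
  have ysX: "set ys \<subseteq> X" using ys xs(3) by auto
  \<comment> \<open>Needed when \<open>ys\<close> is empty, where the closing arc joins the two ends
    directly.\<close>
  have ne: "hd xs \<noteq> last xs"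
  proof
    assume eq: "hd xs = last xs"
    have "xs = [hd xs]"
      using eq xs(1,4) by (cases xs) (auto split: if_splits)
    then have "V - X \<subseteq> {hd xs}" using xs(3) by (metis empty_set list.simps(15))
    then have "V - X = {}" using ends(1) by auto
    then show False using card_outside by (metis card.empty zero_neq_numeral)
  qed
  have "successively (\<lambda>u v. (u, v) \<in> E) (ys @ [hd xs])"
    using ys ysX xs(4) ends(1) by (intro successively_clique) auto
  moreover have "(last xs, hd (ys @ [hd xs])) \<in> E"
  proof (rule clique)
    show "last xs \<noteq> hd (ys @ [hd xs])"
      using ne ys(1) xs(4) hd_in_set[of ys] last_in_set[of xs] by (cases ys) auto
    show "hd (ys @ [hd xs]) \<in> X"
      using ysX ends(1) by (cases ys) auto
  qed (rule ends)
  ultimately have "successively (\<lambda>u v. (u, v) \<in> E) ((xs @ ys) @ [hd (xs @ ys)])"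
    using path xs(4) by (simp add: successively_append_iff)
  moreover have "distinct (xs @ ys)" "set (xs @ ys) = V"
    using ys xs by auto
  moreover have "3 \<le> length (xs @ ys)"
    using calculation(2,3) distinct_card card_V by (metis le_add2)
  ultimately show False
    using non_ham unfolding hamiltonian_def by blast
qed

text \<open>The clique carries label 0, and with fewer than five vertices \<open>S\<close> cannot
  swallow it. So 0 is a label besides those in \<open>L\<close>, and toughness gives
  \<open>card L + 1 \<le> card S\<close>.\<close>

lemma tough_labels:
  assumes S: "S \<subseteq> V" "card S < 5"
    and f0: "\<And>x. x \<in> X \<Longrightarrow> f x = (0 :: nat)"
    and f: "\<And>u v. u \<in> V - X \<Longrightarrow> u \<notin> S \<Longrightarrow> v \<notin> S \<Longrightarrow> (u, v) \<in> E \<Longrightarrow> f u = f v"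
    and L: "L \<subseteq> f ` (V - X - S)" "0 \<notin> L" "L \<noteq> {}"
  shows "card L < card S"
proof -
  have edge_labels: "f u = f v" if "(u, v) \<in> E" "u \<notin> S" "v \<notin> S" for u v
  proof (cases "u \<in> X")
    case True
    show ?thesis
    proof (cases "v \<in> X")
      case True
      then show ?thesis using \<open>u \<in> X\<close> f0 by simp
    next
      case False
      then show ?thesis using that f[of v u] edge_verts edge_sym by auto
    qed
  next
    case False
    then show ?thesis using that f[of u v] edge_verts by auto
  qed
  have fS: "finite S" using S(1) finite_V by (rule finite_subset)
  have "\<not> X \<subseteq> S"
    using card_mono[OF fS, of X] S(2) card_X by linarith
  then obtain x where x: "x \<in> X" "x \<notin> S" by blast
  have sub: "insert 0 L \<subseteq> f ` (V - S)"
  proof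
    fix l assume l: "l \<in> insert 0 L"
    show "l \<in> f ` (V - S)"
    proof (cases "l = 0")
      case True
      then show ?thesis
        using x f0[OF x(1)] X_subset by (intro rev_image_eqI[of x]) auto
    next
      case False
      then show ?thesis using l L(1) by auto
    qed
  qed
  have fL: "finite L"
    using L(1) by (rule finite_subset) (simp add: finite_V)
  have "Suc (card L) = card (insert 0 L)"
    using fL L(2) by simp
  also have "\<dots> \<le> card (f ` (V - S))"
    using sub finite_V by (intro card_mono) auto
  finally have le: "Suc (card L) \<le> card (f ` (V - S))" .
  have "0 < card L" using L(3) fL by (simp add: card_gt_0_iff)
  with le have "1 < card (f ` (V - S))" by simp
  moreover have "\<forall>u v. (u, v) \<in> E \<longrightarrow> u \<notin> S \<longrightarrow> v \<notin> S \<longrightarrow> f u = f v"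
    using edge_labels by blast
  ultimately have "card (f ` (V - S)) \<le> card S"
    using tough S(1) unfolding one_tough_def by simp
  then show ?thesis using le by simp
qed

lemma nbr_of_outside_degree:
  assumes "x \<in> X" "w \<in> V - X" "(w, x) \<in> E"
  shows "card V \<le> card (E `` {x}) + 3"
proof -
  have "card (insert w (X - {x})) \<le> card (E `` {x})"
    using assms clique edge_sym by (intro card_mono finite_nbrs) auto
  then show ?thesis
    using assms finite_X card_V card_X by simp
qed

text \<open>The degree of \<open>x\<close> is at least \<open>card V - 3\<close>, so a nonadjacent
  vertex of degree 3 would violate closedness.\<close>

lemma nbr_of_high_degree:
  assumes x: "x \<in> N w" and w: "w \<in> V - X" "w' \<in> V - X" and d: "3 \<le> card (E `` {w'})"
  shows "x \<in> N w'"
proof (rule ccontr)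
  assume "x \<notin> N w'"
  then have "(w', x) \<notin> E" using x by (simp add: N_iff)
  moreover have "w' \<noteq> x" "x \<in> V" using x w X_subset by (auto simp: N_iff)
  ultimately have "card (E `` {w'}) + card (E `` {x}) < card V"
    using closed w unfolding ore_closed_def by blast
  then show False
    using nbr_of_outside_degree[of x w] x w d by (simp add: N_iff)
qed

text \<open>Two outside neighbours raise the degree of \<open>x\<close> to
  \<open>card V - 2\<close>, so now degree 2 of \<open>w''\<close> suffices.\<close>

lemma common_nbr:
  assumes x: "x \<in> N w" "x \<in> N w'" and w: "w \<in> V - X" "w' \<in> V - X" "w \<noteq> w'" "w'' \<in> V - X"
  shows "x \<in> N w''"
proof (rule ccontr)
  assume "x \<notin> N w''"
  then have "(w'', x) \<notin> E" using x by (simp add: N_iff)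
  moreover have "w'' \<noteq> x" "x \<in> V" using x w X_subset by (auto simp: N_iff)
  ultimately have lt: "card (E `` {w''}) + card (E `` {x}) < card V"
    using closed w unfolding ore_closed_def by blast
  have "card (insert w (insert w' (X - {x}))) \<le> card (E `` {x})"
    using x w clique edge_sym by (intro card_mono finite_nbrs) (auto simp: N_iff)
  then have "card V \<le> card (E `` {x}) + 2"
    using x w finite_X card_V card_X by (simp add: N_iff)
  then show False
    using lt min_deg[of w''] w by simp
qed

lemma nbrs_disjoint_or_common:
  assumes "w \<in> V - X" "w' \<in> V - X" "w'' \<in> V - X" "w \<noteq> w'"
  shows "N w \<inter> N w' \<subseteq> N w''"
  using common_nbr assms by auto

end

lemma two_elements:
  assumes "2 \<le> card A"
  obtains a b where "a \<in> A" "b \<in> A" "a \<noteq> b"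
proof -
  obtain B where "B \<subseteq> A" "card B = 2"
    using obtain_subset_with_card_n[OF assms] by blast
  then show thesis
    using that by (auto simp: card_2_iff)
qed

lemma another_element:
  assumes "finite A" "finite B" "card B < card A"
  obtains a where "a \<in> A" "a \<notin> B"
  using assms card_mono[of B A] by force

section \<open>Edges among the three outside vertices\<close>

locale outside_triple = tough_clique_graph +
  fixes p q r :: 'a
  assumes outside: "V - X = {p, q, r}"
    and distinct_pqr: "p \<noteq> q" "p \<noteq> r" "q \<noteq> r"
begin

lemma in_outside [simp]:
  "p \<in> V" "q \<in> V" "r \<in> V" "p \<notin> X" "q \<notin> X" "r \<notin> X"
  using outside by auto

lemma clique_vertex_neq [simp]:
  "x \<in> X \<Longrightarrow> (x = p) = False" "x \<in> X \<Longrightarrow> (x = q) = False" "x \<in> X \<Longrightarrow> (x = r) = False"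
  "x \<in> X \<Longrightarrow> (p = x) = False" "x \<in> X \<Longrightarrow> (q = x) = False" "x \<in> X \<Longrightarrow> (r = x) = False"
  using in_outside by blast+

lemma edge_from_outside: "w \<in> V - X \<Longrightarrow> (w, v) \<in> E \<Longrightarrow> v \<in> N w \<or> v \<in> {p, q, r}"
  using outside edge_verts by (auto simp: N_iff)

text \<open>Here \<open>S\<close> contains every clique neighbour of the surviving outside vertices,
  which are therefore cut off from the clique; \<open>g\<close> labels the pieces they form, and
  positivity keeps these labels apart from 0.\<close>

lemma tough_triple:
  fixes g :: "'a \<Rightarrow> nat"
  assumes S: "S \<subseteq> V" "card S < 5"
    and N: "\<And>w. w \<in> {p, q, r} - S \<Longrightarrow> N w \<subseteq> S"
    and g: "\<And>u v. u \<in> {p, q, r} - S \<Longrightarrow> v \<in> {p, q, r} - S \<Longrightarrow> (u, v) \<in> E \<Longrightarrow> g u = g v"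
    and pos: "\<And>w. g w > 0" and ne: "{p, q, r} - S \<noteq> {}"
  shows "card (g ` ({p, q, r} - S)) < card S"
proof (rule tough_labels[where f = "\<lambda>v. if v \<in> X then 0 else g v"])
  show "g ` ({p, q, r} - S) \<subseteq> (\<lambda>v. if v \<in> X then 0 else g v) ` (V - X - S)"
    unfolding outside by (rule image_subsetI, rule rev_image_eqI) (use in_outside in auto)
  show "0 \<notin> g ` ({p, q, r} - S)"
    using pos by (auto simp: image_iff)
  show "g ` ({p, q, r} - S) \<noteq> {}"
    using ne by (simp only: image_is_empty) simp
  fix u v assume uv: "u \<in> V - X" "u \<notin> S" "v \<notin> S" "(u, v) \<in> E"
  then have u: "u \<in> {p, q, r} - S" using outside by blast
  moreover have v: "v \<in> {p, q, r} - S"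
    using edge_from_outside[OF uv(1,4)] N[OF u] uv(3) by blast
  ultimately have "g u = g v" using g uv(4) by blast
  moreover have "u \<notin> X" "v \<notin> X" using u v in_outside by blast+
  ultimately show "(if u \<in> X then 0 else g u) = (if v \<in> X then 0 else g v)"
    by simp
qed (use S in auto)

lemma N_subset: "N w \<subseteq> V"
  using X_subset by (auto simp: N_def)

lemma not_in_N [simp]: "p \<notin> N w" "q \<notin> N w" "r \<notin> N w"
  by (auto simp: N_def)

lemma nbrs_outside: "w \<in> {p, q, r} \<Longrightarrow> E `` {w} \<subseteq> N w \<union> ({p, q, r} - {w})"
  using edge_from_outside[of w] outside no_loop by blast

lemma no_path:
  assumes "distinct xs" "{p, q, r} \<subseteq> set xs" "xs \<noteq> []" "set xs \<subseteq> X \<union> {p, q, r}"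
    "hd xs \<in> X" "last xs \<in> X" "successively (\<lambda>u v. (u, v) \<in> E) xs"
  shows False
  using no_path_through_outside[of xs] assms outside X_subset by auto

text \<open>In a triangle any two outside vertices can be the ends of a path through all three.
  Toughness gives two attachments in the clique; if they do not yield such a path, they belong to
  one vertex \<open>w\<close> alone, which is then a cut vertex. If \<open>p\<close> and
  \<open>r\<close> are nonadjacent, their only clique neighbour is a common \<open>a\<close>, and
  removing \<open>a\<close> and \<open>q\<close> isolates both.\<close>

lemma connected_outside_false:
  assumes pq: "(p, q) \<in> E" and qr: "(q, r) \<in> E"
  shows False
proof -
  have no: False if "a \<in> N p" "b \<in> N r" "a \<noteq> b" for a b
    using that pq qr distinct_pqr edge_sym
    by (intro no_path[of "[a, p, q, r, b]"]) (auto simp: N_iff)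
  show False
  proof (cases "(p, r) \<in> E")
    case True
    have no': False if "a \<in> N p" "b \<in> N q" "a \<noteq> b" for a b
      using that True qr distinct_pqr edge_sym
      by (intro no_path[of "[a, p, r, q, b]"]) (auto simp: N_iff)
    have no'': False if "a \<in> N q" "b \<in> N r" "a \<noteq> b" for a b
      using that True pq distinct_pqr edge_sym
      by (intro no_path[of "[a, q, p, r, b]"]) (auto simp: N_iff)
    define S where "S = N p \<union> N q \<union> N r"
    have S: "1 < card S"
    proof (rule ccontr)
      assume "\<not> ?thesis"
      moreover have "{p, q, r} - S = {p, q, r}" by (auto simp: S_def)
      ultimately show False
        using tough_triple[of S "\<lambda>_. 1"] N_subset by (auto simp: S_def)
    qed
    then obtain a b where ab: "a \<in> S" "b \<in> S" "a \<noteq> b"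
      using two_elements[of S] by auto
    obtain w where w: "w \<in> {p, q, r}" "\<And>w'. w' \<in> {p, q, r} \<Longrightarrow> w' \<noteq> w \<Longrightarrow> N w' = {}"
    proof -
      have "(N q = {} \<and> N r = {}) \<or> (N p = {} \<and> N r = {}) \<or> (N p = {} \<and> N q = {})"
        using ab no no' no'' unfolding S_def by blast
      then show thesis
        using that[of p] that[of q] that[of r] by blast
    qed
    have "w \<in> V" using w(1) in_outside by blast
    have ne: "{p, q, r} - {w} \<noteq> {}" using distinct_pqr by auto
    have "card ((\<lambda>_. 1 :: nat) ` ({p, q, r} - {w})) < card {w}"
    proof (rule tough_triple)
      fix w' assume "w' \<in> {p, q, r} - {w}"
      then show "N w' \<subseteq> {w}" using w(2)[of w'] by blast
    qed (use \<open>w \<in> V\<close> ne in auto)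
    moreover have "(\<lambda>_. 1 :: nat) ` ({p, q, r} - {w}) = {1}"
      by (simp only: image_constant_conv ne if_False)
    ultimately show False by simp
  next
    case False
    then have rp: "(r, p) \<notin> E" using edge_sym by blast
    have "E `` {p} \<subseteq> insert q (N p)" "E `` {r} \<subseteq> insert q (N r)"
      using False rp nbrs_outside[of p] nbrs_outside[of r] by blast+
    then have "card (E `` {p}) \<le> card (insert q (N p))" "card (E `` {r}) \<le> card (insert q (N r))"
      using finite_N by (blast intro: card_mono finite.insertI)+
    then have "N p \<noteq> {}" "N r \<noteq> {}"
      using min_deg[of p] min_deg[of r] by auto
    then obtain a where "a \<in> N p" by blast
    then have a: "N p = {a}" "N r = {a}"
      using no \<open>N r \<noteq> {}\<close> by blast+
    have aX: "a \<in> X" using a(1) by (auto simp: N_def)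
    have W: "{p, q, r} - {a, q} = {p, r}" using distinct_pqr aX by auto
    have "card ((\<lambda>v. if v = p then 1 else 2 :: nat) ` ({p, q, r} - {a, q})) < card {a, q}"
      unfolding W[symmetric]
      by (rule tough_triple) (use aX X_subset a False rp W no_loop in \<open>auto simp: card_insert_if\<close>)
    then show False
      using distinct_pqr aX unfolding W by simp
  qed
qed

text \<open>A segment \<open>a, p, q, b\<close> and a segment \<open>g, r, h\<close> combine into
  one path unless they have the same pair of ends. Toughness supplies a third attachment
  \<open>e\<close>, and exchanging one end for \<open>e\<close> separates the two pairs.\<close>

lemma single_edge_outside_false:
  assumes pq: "(p, q) \<in> E" and pr: "(p, r) \<notin> E" and qr: "(q, r) \<notin> E"
  shows False
proof -
  have rp: "(r, p) \<notin> E" and rq: "(r, q) \<notin> E" using pr qr edge_sym by auto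
  have no: False if "a \<in> N p" "b \<in> N q" "a \<noteq> b" "g \<in> N r" "h \<in> N r" "g \<noteq> h" "{a, b} \<noteq> {g, h}" for a b g h
  proof -
    consider "a = g" | "a = h" | "b = g" | "b = h" | "a \<notin> {g, h}" "b \<notin> {g, h}" by blast
    then show False
    proof cases
      case 1
      then show False using that pq distinct_pqr edge_sym
        by (intro no_path[of "[b, q, p, a, r, h]"]) (auto simp: N_iff)
    next
      case 2
      then show False using that pq distinct_pqr edge_sym
        by (intro no_path[of "[b, q, p, a, r, g]"]) (auto simp: N_iff)
    next
      case 3
      then show False using that pq distinct_pqr edge_sym
        by (intro no_path[of "[a, p, q, b, r, h]"]) (auto simp: N_iff)
    next
      case 4
      then show False using that pq distinct_pqr edge_sym
        by (intro no_path[of "[a, p, q, b, r, g]"]) (auto simp: N_iff)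
    next
      case 5
      then show False using that pq distinct_pqr edge_sym clique[of b g]
        by (intro no_path[of "[a, p, q, b, g, r, h]"]) (auto simp: N_iff)
    qed
  qed
  have Er: "E `` {r} = N r"
    using rp rq nbrs_outside[of r] by (auto simp: N_iff)
  have "E `` {p} \<subseteq> insert q (N p)" "E `` {q} \<subseteq> insert p (N q)"
    using pr qr nbrs_outside[of p] nbrs_outside[of q] by blast+
  then have "card (E `` {p}) \<le> card (insert q (N p))" "card (E `` {q}) \<le> card (insert p (N q))"
    using finite_N by (blast intro: card_mono finite.insertI)+
  then have ne: "N p \<noteq> {}" "N q \<noteq> {}"
    using min_deg[of p] min_deg[of q] by auto
  let ?g = "\<lambda>v. if v = r then 1 else 2 :: nat"
  have "1 < card (N p \<union> N q)"
  proof (rule ccontr)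
    assume c: "\<not> ?thesis"
    have "card {1 :: nat} < card (N p \<union> N q)"
    \<comment> \<open>Neighbours of \<open>r\<close> may survive the deletion, so \<open>r\<close>
      shares label 0 with the clique.\<close>
    proof (rule tough_labels[where f = "\<lambda>v. if v \<in> {p, q} then 1 else 0"])
      show "N p \<union> N q \<subseteq> V" using N_subset by blast
      show "card (N p \<union> N q) < 5" using c by simp
      show "{1} \<subseteq> (\<lambda>v. if v \<in> {p, q} then 1 else 0) ` (V - X - (N p \<union> N q))"
        unfolding outside by (auto intro!: rev_image_eqI[of p])
      fix u v assume uv: "u \<in> V - X" "u \<notin> N p \<union> N q" "v \<notin> N p \<union> N q" "(u, v) \<in> E"
      then consider "u = p" | "u = q" | "u = r" using outside by blast
      then show "(if u \<in> {p, q} then 1 else 0) = (if v \<in> {p, q} then 1 else 0)"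
        using uv nbrs_outside[of p] nbrs_outside[of q] pr qr rp rq by cases auto
    qed auto
    with c show False by simp
  qed
  then obtain x y where "x \<in> N p \<union> N q" "y \<in> N p \<union> N q" "x \<noteq> y"
    using two_elements[of "N p \<union> N q"] by auto
  then obtain a b where ab: "a \<in> N p" "b \<in> N q" "a \<noteq> b"
    using ne by blast
  have "2 < card (N p \<union> N q \<union> N r)"
  proof (rule ccontr)
    assume c: "\<not> ?thesis"
    have W: "{p, q, r} - (N p \<union> N q \<union> N r) = {p, q, r}" by auto
    have "card (?g ` ({p, q, r} - (N p \<union> N q \<union> N r))) < card (N p \<union> N q \<union> N r)"
      by (rule tough_triple) (use c W N_subset pr qr rp rq in auto)
    moreover have "?g ` {p, q, r} = {1, 2}" using distinct_pqr by auto
    ultimately have "card {1, 2 :: nat} < card (N p \<union> N q \<union> N r)"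
      unfolding W by simp
    with c show False by simp
  qed
  then obtain e where e: "e \<in> N p \<union> N q \<union> N r" "e \<notin> {a, b}"
    using another_element[of "N p \<union> N q \<union> N r" "{a, b}"] finite_N ab by auto
  obtain g h where gh: "g \<in> N r" "h \<in> N r" "g \<noteq> h"
    using min_deg[of r] two_elements[of "N r"] Er by auto
  show False
  proof (cases "{a, b} = {g, h}")
    case False
    then show False using no ab gh by blast
  next
    case True
    consider "e \<in> N p" | "e \<in> N q" | "e \<in> N r" using e by blast
    then show False
    proof cases
      case 1
      then show False using no[of e b g h] ab gh True e by auto
    next
      case 2
      then show False using no[of a e g h] ab gh True e by auto
    next
      case 3
      then show False using no[of a b e g] ab gh True e by (auto simp: doubleton_eq_iff)
    qed
  qed
qed

end

section \<open>Three independent outside vertices\<close>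

locale independent_triple = outside_triple +
  assumes indep: "(p, q) \<notin> E" "(p, r) \<notin> E" "(q, r) \<notin> E"
begin

lemma non_adjacent: "u \<in> {p, q, r} \<Longrightarrow> v \<in> {p, q, r} \<Longrightarrow> (u, v) \<notin> E"
  using indep no_loop edge_sym by blast

lemma N_eq: "w \<in> {p, q, r} \<Longrightarrow> E `` {w} = N w"
  using nbrs_outside[of w] non_adjacent by (auto simp: N_iff)

lemma card_N: "w \<in> {p, q, r} \<Longrightarrow> 2 \<le> card (N w)"
  using min_deg[of w] N_eq[of w] by auto

text \<open>Deleting the neighbours of \<open>p\<close> and \<open>q\<close> isolates both, and the
  clique is a third piece. As neighbours of \<open>r\<close> may survive, \<open>r\<close> is
  counted with the clique.\<close>

lemma two_nbrhoods: "3 \<le> card (N p \<union> N q)"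
proof (rule ccontr)
  assume c: "\<not> ?thesis"
  let ?f = "\<lambda>v. if v = p then 1 else if v = q then 2 else 0 :: nat"
  have "card {1, 2 :: nat} < card (N p \<union> N q)"
  proof (rule tough_labels[where f = ?f])
    show "N p \<union> N q \<subseteq> V" using N_subset by blast
    show "card (N p \<union> N q) < 5" using c by simp
    show "{1, 2} \<subseteq> ?f ` (V - X - (N p \<union> N q))"
      unfolding outside using distinct_pqr
      by (auto intro: rev_image_eqI[of p] rev_image_eqI[of q])
    fix u v assume uv: "u \<in> V - X" "u \<notin> N p \<union> N q" "v \<notin> N p \<union> N q" "(u, v) \<in> E"
    then consider "u = p" | "u = q" | "u = r" using outside by blast
    then show "?f u = ?f v"
    proof cases
      case 3
      then have "v \<noteq> p" "v \<noteq> q" using uv(4) non_adjacent by blast+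
      then show ?thesis using 3 distinct_pqr by simp
    qed (use uv(3,4) N_eq in auto)
  qed auto
  with c show False by simp
qed

lemma three_nbrhoods: "4 \<le> card (N p \<union> N q \<union> N r)"
proof (rule ccontr)
  assume c: "\<not> ?thesis"
  let ?g = "\<lambda>v. if v = p then 1 else if v = q then 2 else 3 :: nat"
  have W: "{p, q, r} - (N p \<union> N q \<union> N r) = {p, q, r}" by auto
  have "card (?g ` ({p, q, r} - (N p \<union> N q \<union> N r))) < card (N p \<union> N q \<union> N r)"
  proof (rule tough_triple)
    fix u v assume "u \<in> {p, q, r} - (N p \<union> N q \<union> N r)" "v \<in> {p, q, r} - (N p \<union> N q \<union> N r)" "(u, v) \<in> E"
    then show "?g u = ?g v" using non_adjacent by blast
  qed (use c N_subset W in auto)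
  moreover have "?g ` {p, q, r} = {1, 2, 3}" using distinct_pqr by auto
  ultimately have "card {1, 2, 3 :: nat} < card (N p \<union> N q \<union> N r)"
    unfolding W by simp
  with c show False by simp
qed

text \<open>Vertices with three or more neighbours see all of \<open>T\<close>, which has at least
  four elements: enough to thread \<open>p\<close>, \<open>q\<close>, \<open>r\<close> in turn with
  distinct clique vertices.\<close>

lemma two_high_false:
  assumes q: "3 \<le> card (N q)" and r: "3 \<le> card (N r)"
  shows False
proof -
  define T where "T = N p \<union> N q \<union> N r"
  have T: "N q = T" "N r = T"
    unfolding T_def using nbr_of_high_degree[of _ p q] nbr_of_high_degree[of _ r q]
      nbr_of_high_degree[of _ p r] nbr_of_high_degree[of _ q r] q r N_eq by auto
  have cT: "4 \<le> card T" using three_nbrhoods by (simp add: T_def)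
  have fT: "finite T" using finite_N by (simp add: T_def)
  obtain a b where ab: "a \<in> N p" "b \<in> N p" "a \<noteq> b"
    using two_elements[of "N p"] card_N by auto
  obtain c where c: "c \<in> T" "c \<notin> {a, b}"
    using another_element[of T "{a, b}"] fT cT ab by auto
  have "card {a, b, c} < card T" using cT by (simp add: card_insert_if)
  then obtain d where d: "d \<in> T" "d \<notin> {a, b, c}"
    using another_element[OF fT, of "{a, b, c}"] by auto
  have "b \<in> N q" "c \<in> N q" "c \<in> N r" "d \<in> N r"
    using ab c d T unfolding T_def by auto
  then show False
    using ab c d distinct_pqr edge_sym
    by (intro no_path[of "[a, p, b, q, c, r, d]"]) (auto simp: N_iff)
qed

text \<open>As \<open>r\<close> sees all of \<open>T\<close>, it can link the segments through
  \<open>p\<close> and \<open>q\<close> if these are disjoint. Otherwise they share \<open>b\<close>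
  and form one path, which is extended through \<open>r\<close> to a fourth element of
  \<open>T\<close>.\<close>

lemma one_high_false:
  assumes p: "card (N p) = 2" and q: "card (N q) = 2" and r: "3 \<le> card (N r)"
  shows False
proof -
  define T where "T = N p \<union> N q \<union> N r"
  have T: "N r = T"
    unfolding T_def using nbr_of_high_degree[of _ p r] nbr_of_high_degree[of _ q r] r N_eq by auto
  have cT: "4 \<le> card T" using three_nbrhoods by (simp add: T_def)
  have fT: "finite T" using finite_N by (simp add: T_def)
  have sub: "N p \<subseteq> N r" "N q \<subseteq> N r" using T unfolding T_def by auto
  show False
  proof (cases "N p \<inter> N q = {}")
    case True
    obtain a b where ab: "a \<in> N p" "b \<in> N p" "a \<noteq> b"
      using two_elements[of "N p"] p by auto
    obtain e f where ef: "e \<in> N q" "f \<in> N q" "e \<noteq> f"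
      using two_elements[of "N q"] q by auto
    have "a \<noteq> e" "a \<noteq> f" "b \<noteq> e" "b \<noteq> f" "b \<in> N r" "e \<in> N r"
      using ab ef True sub by auto
    then show False
      using ab ef distinct_pqr edge_sym
      by (intro no_path[of "[a, p, b, r, e, q, f]"]) (auto simp: N_iff)
  next
    case False
    then obtain b where b: "b \<in> N p" "b \<in> N q" by blast
    obtain a where a: "a \<in> N p" "a \<noteq> b"
      using another_element[of "N p" "{b}"] finite_N p by auto
    obtain e where e: "e \<in> N q" "e \<noteq> b"
      using another_element[of "N q" "{b}"] finite_N q by auto
    have "N p = {a, b}"
      using a b p finite_N by (intro card_subset_eq[symmetric]) auto
    moreover have "N q = {e, b}"
      using e b q finite_N by (intro card_subset_eq[symmetric]) auto
    ultimately have "N p \<union> N q = {a, b, e}" by auto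
    then have "a \<noteq> e"
      using two_nbrhoods a(2) by (auto simp: card_insert_if split: if_splits)
    have "card {a, b, e} < card T" using cT by (simp add: card_insert_if)
    then obtain d where d: "d \<in> T" "d \<notin> {a, b, e}"
      using another_element[OF fT, of "{a, b, e}"] by auto
    have "e \<in> N r" "d \<in> N r" using e d T sub by auto
    then show False
      using a b e d \<open>a \<noteq> e\<close> distinct_pqr edge_sym
      by (intro no_path[of "[a, p, b, q, e, r, d]"]) (auto simp: N_iff)
  qed
qed

text \<open>The preceding lemmas single out positions, but only the number of vertices with three or
  more neighbours matters, so cyclic rotations cover every case.\<close>

lemma rotate: "independent_triple V E X q r p"
  using outside distinct_pqr non_adjacent
  by unfold_locales auto

text \<open>Without a vertex common to all three neighbourhoods, these are pairwise disjoint by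
  \<open>common_nbr\<close>, and clique edges link the three segments into a path. The second
  neighbours differ because any two neighbourhoods have a union of at least three vertices.\<close>

lemma star:
  obtains c a b d where "E `` {p} = {c, a}" "E `` {q} = {c, b}" "E `` {r} = {c, d}"
    "distinct [c, a, b, d]" "{c, a, b, d} \<subseteq> X"
proof -
  interpret q: independent_triple V E X q r p by (rule rotate)
  interpret r: independent_triple V E X r p q by (rule q.rotate)
  have "card (N w) = 2 \<or> 3 \<le> card (N w)" if "w \<in> {p, q, r}" for w
    using card_N[OF that] by linarith
  then have two: "card (N p) = 2" "card (N q) = 2" "card (N r) = 2"
    using one_high_false q.one_high_false r.one_high_false
      two_high_false q.two_high_false r.two_high_false by blast+
  have common: "N p \<inter> N q \<subseteq> N r" "N q \<inter> N r \<subseteq> N p" "N r \<inter> N p \<subseteq> N q"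
    using distinct_pqr nbrs_disjoint_or_common[of p q r] nbrs_disjoint_or_common[of q r p]
      nbrs_disjoint_or_common[of r p q] by simp_all
  have "\<exists>c. c \<in> N p \<inter> N q \<inter> N r"
  proof (rule ccontr)
    assume "\<not> ?thesis"
    then have disj: "N p \<inter> N q = {}" "N q \<inter> N r = {}" "N r \<inter> N p = {}"
      using common by blast+
    obtain a b where ab: "a \<in> N p" "b \<in> N p" "a \<noteq> b"
      using two_elements[of "N p"] two by auto
    obtain e f where ef: "e \<in> N q" "f \<in> N q" "e \<noteq> f"
      using two_elements[of "N q"] two by auto
    obtain g h where gh: "g \<in> N r" "h \<in> N r" "g \<noteq> h"
      using two_elements[of "N r"] two by auto
    have ne: "a \<noteq> e" "a \<noteq> f" "a \<noteq> g" "a \<noteq> h" "b \<noteq> e" "b \<noteq> f" "b \<noteq> g" "b \<noteq> h"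
      "e \<noteq> g" "e \<noteq> h" "f \<noteq> g" "f \<noteq> h"
      using ab ef gh disj by blast+
    then have "(b, e) \<in> E" "(f, g) \<in> E"
      using ab ef gh by (auto intro!: clique simp: N_iff)
    then show False
      using ab ef gh ne distinct_pqr edge_sym
      by (intro no_path[of "[a, p, b, e, q, f, g, r, h]"]) (auto simp: N_iff)
  qed
  then obtain c where c: "c \<in> N p" "c \<in> N q" "c \<in> N r" by blast
  have "\<exists>x. N w = {c, x} \<and> x \<noteq> c" if "card (N w) = 2" "c \<in> N w" for w
    using that by (auto simp: card_2_iff)
  then obtain a b d where abd: "N p = {c, a}" "a \<noteq> c" "N q = {c, b}" "b \<noteq> c" "N r = {c, d}" "d \<noteq> c"
    using two c by metis
  have "N p \<noteq> N q" "N q \<noteq> N r" "N r \<noteq> N p"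
    using two_nbrhoods q.two_nbrhoods r.two_nbrhoods two by auto
  then have "distinct [c, a, b, d]" using abd by auto
  moreover have "{c, a, b, d} \<subseteq> X"
    using abd by (auto simp: N_def)
  ultimately show thesis
    using abd N_eq by (intro that[of c a b d]) auto
qed

end

context outside_triple
begin

lemma rotate_outside: "outside_triple V E X q r p"
  using outside distinct_pqr by unfold_locales auto

lemma independent: "independent_triple V E X p q r"
proof -
  interpret q: outside_triple V E X q r p by (rule rotate_outside)
  interpret r: outside_triple V E X r p q by (rule q.rotate_outside)
  have "(p, q) \<notin> E" "(q, r) \<notin> E" "(r, p) \<notin> E"
    using connected_outside_false q.connected_outside_false r.connected_outside_false
      single_edge_outside_false q.single_edge_outside_false r.single_edge_outside_false edge_sym
    by metis+
  then show ?thesis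
    using edge_sym by unfold_locales auto
qed

end

context tough_clique_graph
begin

lemma outside_star:
  obtains p q r c a b d where "V - X = {p, q, r}" "distinct [p, q, r]"
    "E `` {p} = {c, a}" "E `` {q} = {c, b}" "E `` {r} = {c, d}"
    "distinct [c, a, b, d]" "{c, a, b, d} \<subseteq> X"
proof -
  obtain p q r where pqr: "V - X = {p, q, r}" "p \<noteq> q" "p \<noteq> r" "q \<noteq> r"
    using card_outside by (auto simp: card_3_iff)
  interpret outside_triple V E X p q r
    using pqr by unfold_locales auto
  interpret independent_triple V E X p q r by (rule independent)
  have "distinct [p, q, r]" using pqr by simp
  then show thesis
    using star that[OF pqr(1)] by metis
qed

end

section \<open>Arc walks, components and adjacency matrices\<close>

lemma pair_graph_ugraph:
  assumes "pair_graph G"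
  shows "ugraph (pverts G) (parcs G)"
proof -
  interpret pair_graph G by fact
  show ?thesis
  proof
    show "sym (parcs G)"
      using arcs_symmetric by (auto intro: symI)
    show "irrefl (parcs G)"
      using no_loops' by (auto simp: irrefl_def)
  qed (auto simp: in_arcsD1 in_arcsD2 pair_finite_verts)
qed

lemma vertex_list:
  assumes "finite (pverts G)"
  shows "distinct (vertex_list G)" "set (vertex_list G) = pverts G"
proof -
  have "\<exists>vs. distinct vs \<and> set vs = pverts G"
    using finite_distinct_list[OF assms] by blast
  then have "distinct (vertex_list G) \<and> set (vertex_list G) = pverts G"
    unfolding vertex_list_def by (rule someI_ex)
  then show "distinct (vertex_list G)" "set (vertex_list G) = pverts G"
    by blast+
qed

text \<open>Eigenvectors become functions on the vertices, which removes the arbitrary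
  enumeration.\<close>

lemma spectrum_adjacency_matrix:
  assumes G: "ugraph (pverts G) (parcs G)"
  shows "k \<in> spectrum (adjacency_matrix G) \<longleftrightarrow>
    (\<exists>x. (\<exists>v\<in>pverts G. x v \<noteq> 0) \<and> (\<forall>u\<in>pverts G. (\<Sum>v\<in>parcs G `` {u}. x v) = k * x u))"
    (is "?L \<longleftrightarrow> ?R")
proof -
  interpret ugraph "pverts G" "parcs G" by fact
  define vs where "vs = vertex_list G"
  define n where "n = card (pverts G)"
  define A where "A = adjacency_matrix G"
  have vs: "distinct vs" "set vs = pverts G"
    using vertex_list[OF finite_V] by (auto simp: vs_def)
  have len: "length vs = n"
    using distinct_card[OF vs(1)] vs(2) by (simp add: n_def)
  have A: "A = mat n n (\<lambda>(i, j). if (vs ! i, vs ! j) \<in> parcs G then 1 else 0)"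
    by (simp add: A_def adjacency_matrix_def n_def vs_def)
  have bij: "bij_betw ((!) vs) {..<n} (pverts G)"
    using bij_betw_nth[OF vs(1)] vs(2) len by auto
  have mult: "(A *\<^sub>v vec n (\<lambda>i. x (vs ! i))) $ i = (\<Sum>v\<in>parcs G `` {vs ! i}. x v)"
    if "i < n" for i x
  proof -
    have "(A *\<^sub>v vec n (\<lambda>i. x (vs ! i))) $ i =
        (\<Sum>j\<in>{..<n}. if (vs ! i, vs ! j) \<in> parcs G then x (vs ! j) else 0)"
      using that by (auto simp: A scalar_prod_def atLeast0LessThan intro!: sum.cong)
    also have "\<dots> = (\<Sum>v\<in>pverts G. if (vs ! i, v) \<in> parcs G then x v else 0)"
      by (rule sum.reindex_bij_betw[OF bij])
    also have "\<dots> = (\<Sum>v\<in>parcs G `` {vs ! i}. x v)"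
      using nbrs_subset finite_V
      by (subst sum.inter_filter[symmetric]) (auto intro!: sum.cong)
    finally show ?thesis .
  qed
  have dimA: "dim_row A = n" by (simp add: A)
  show ?thesis
  proof
    assume ?L
    then obtain w where w: "w \<in> carrier_vec n" "w \<noteq> 0\<^sub>v n" "A *\<^sub>v w = k \<cdot>\<^sub>v w"
      unfolding spectrum_def eigenvalue_def eigenvector_def A_def[symmetric] dimA by auto
    define x where "x = (\<lambda>v. w $ (the_inv_into {..<n} ((!) vs) v))"
    have inj: "inj_on ((!) vs) {..<n}" using bij by (auto simp: bij_betw_def)
    have xv: "x (vs ! i) = w $ i" if "i < n" for i
      using that by (simp add: x_def the_inv_into_f_f[OF inj])
    have wx: "w = vec n (\<lambda>i. x (vs ! i))"
      using w(1) by (auto simp: xv)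
    have "\<exists>i<n. w $ i \<noteq> 0"
    proof (rule ccontr)
      assume "\<not> ?thesis"
      then have "w = 0\<^sub>v n"
        using w(1) by (intro eq_vecI) auto
      with w(2) show False by simp
    qed
    then obtain i where i: "i < n" "w $ i \<noteq> 0" by blast
    have "(\<Sum>v\<in>parcs G `` {u}. x v) = k * x u" if u: "u \<in> pverts G" for u
    proof -
      obtain j where j: "j < n" "u = vs ! j"
        using u in_set_conv_nth[of u vs] unfolding vs(2) len by blast
      have "(\<Sum>v\<in>parcs G `` {u}. x v) = (A *\<^sub>v w) $ j"
        using mult[OF j(1), of x] j(2) unfolding wx[symmetric] by simp
      also have "\<dots> = k * w $ j"
        using w(1,3) j(1) by simp
      finally show ?thesis
        using xv[OF j(1)] j(2) by simp
    qed
    moreover have "vs ! i \<in> pverts G" "x (vs ! i) \<noteq> 0"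
      using i xv vs(2) len by auto
    ultimately show ?R by blast
  next
    assume ?R
    then obtain x v where v: "v \<in> pverts G" "x v \<noteq> 0"
      and ev: "\<forall>u\<in>pverts G. (\<Sum>v\<in>parcs G `` {u}. x v) = k * x u" by auto
    define w where "w = vec n (\<lambda>i. x (vs ! i))"
    obtain j where j: "j < n" "v = vs ! j"
      using v in_set_conv_nth[of v vs] unfolding vs(2) len by blast
    then have "w $ j \<noteq> 0"
      using v by (simp add: w_def)
    then have "w \<noteq> 0\<^sub>v n"
      using j by auto
    moreover have "A *\<^sub>v w = k \<cdot>\<^sub>v w"
    proof (rule eq_vecI)
      fix i assume "i < dim_vec (k \<cdot>\<^sub>v w)"
      then have i: "i < n" by (simp add: w_def)
      then have "vs ! i \<in> pverts G"
        using nth_mem[of i vs] vs(2) len by simp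
      then show "(A *\<^sub>v w) $ i = (k \<cdot>\<^sub>v w) $ i"
        using i mult[OF i, of x] ev by (simp add: w_def)
    qed (simp add: w_def A)
    ultimately have "eigenvector A w k"
      unfolding eigenvector_def dimA by (simp add: w_def)
    then show ?L
      unfolding spectrum_def eigenvalue_def A_def[symmetric] by blast
  qed
qed

lemma graph_index_spectral_radius:
  assumes G: "ugraph (pverts G) (parcs G)" and "pverts G \<noteq> {}"
  shows "graph_index (pverts G) (parcs G) (\<rho> G)"
proof -
  interpret ugraph "pverts G" "parcs G" by fact
  obtain r where r: "graph_index (pverts G) (parcs G) r"
    using graph_index_exists assms(2) by auto
  have fin: "finite (spectrum (adjacency_matrix G))"
    by (rule card_finite_spectrum[where n = "card (pverts G)"]) (simp add: adjacency_matrix_def)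
  have "r \<in> spectrum (adjacency_matrix G)"
    unfolding spectrum_adjacency_matrix[OF G] using r by (auto simp: graph_index_def)
  moreover have "k \<le> r" if "k \<in> spectrum (adjacency_matrix G)" for k
    using that eigenvalue_le_index[OF r] unfolding spectrum_adjacency_matrix[OF G] by auto
  ultimately have "\<rho> G = r"
    unfolding graph_spectral_radius_def using fin by (intro Max_eqI)
  with r show ?thesis by simp
qed

section \<open>From vertex lists to cycles of arcs\<close>

lemma vertex_list_walk:
  assumes "successively (\<lambda>u v. (u, v) \<in> E) ws" "ws \<noteq> []"
  shows "pcas (hd ws) (zip ws (tl ws)) (last ws)"
    and "pawalk_verts (hd ws) (zip ws (tl ws)) = ws"
    and "set (zip ws (tl ws)) \<subseteq> E"
proof -
  have "pcas (hd ws) (zip ws (tl ws)) (last ws) \<and> pawalk_verts (hd ws) (zip ws (tl ws)) = ws \<and>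
      set (zip ws (tl ws)) \<subseteq> E"
    using assms by (induction ws rule: induct_list012) auto
  then show "pcas (hd ws) (zip ws (tl ws)) (last ws)"
    "pawalk_verts (hd ws) (zip ws (tl ws)) = ws" "set (zip ws (tl ws)) \<subseteq> E"
    by blast+
qed

lemma hamiltonian_imp_hamiltonian_cycle:
  assumes "hamiltonian (pverts G) (parcs G)"
  shows "\<exists>p. hamiltonian_cycle (with_proj G) p"
proof -
  obtain vs where vs: "distinct vs" "set vs = pverts G" "3 \<le> length vs"
    and cyc: "successively (\<lambda>u v. (u, v) \<in> parcs G) (vs @ [hd vs])"
    using assms unfolding hamiltonian_def by blast
  define ws where "ws = vs @ [hd vs]"
  define p where "p = zip ws (tl ws)"
  have ne: "vs \<noteq> []" using vs(3) by auto
  have hd_last: "hd ws = hd vs" "last ws = hd vs"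
    using ne by (auto simp: ws_def)
  note walk = vertex_list_walk[OF cyc[folded ws_def], folded p_def, unfolded hd_last]
  have len: "length p = length vs"
    by (simp add: p_def ws_def)
  have "map fst p = vs"
    by (simp add: p_def ws_def map_fst_zip_take)
  then have tails: "fst ` set p = pverts G"
    using vs(2) by (metis list.set_map)
  have "pre_digraph.awalk (with_proj G) (hd vs) p (hd vs)"
    unfolding pre_digraph.awalk_def
    using walk ne vs(2) hd_in_set[OF ne] by (simp add: ws_def cas_with_proj_eq)
  moreover have "distinct (tl (pre_digraph.awalk_verts (with_proj G) (hd vs) p))"
    using walk(2) ne vs(1) by (cases vs) (auto simp: ws_def awalk_verts_with_proj_eq)
  moreover have "p \<noteq> []" using len ne by auto
  ultimately have "pre_digraph.cycle (with_proj G) p"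
    unfolding pre_digraph.cycle_def by blast
  then have "hamiltonian_cycle (with_proj G) p"
    unfolding hamiltonian_cycle_def using len vs(3) tails by simp
  then show ?thesis ..
qed

section \<open>Labels and connected components\<close>

lemma connected_label_constant:
  assumes "Digraph_Component.connected C"
    and "\<And>e. e \<in> arcs C \<Longrightarrow> f (tail C e) = f (head C e)"
    and "u \<in> verts C" "v \<in> verts C"
  shows "f u = f v"
proof -
  have "u \<rightarrow>\<^sup>*\<^bsub>with_proj (mk_symmetric C)\<^esub> v"
    using assms unfolding Digraph_Component.connected_def strongly_connected_def by (simp add: mk_symmetric_def)
  then show ?thesis
    unfolding reachable_def
  proof (induction rule: rtrancl_on_induct)
    case (step x y)
    then show ?case
      using assms(2) by (auto simp: mk_symmetric_def)
  qed simp
qed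

lemma finite_subgraphs:
  assumes "finite (verts H)" "finite (arcs H)"
  shows "finite {C. subgraph C H}"
proof (rule finite_subset)
  show "{C. subgraph C H} \<subseteq> (\<lambda>(A, B). \<lparr>verts = A, arcs = B, tail = tail H, head = head H\<rparr>) `
      (Pow (verts H) \<times> Pow (arcs H))"
  proof
    fix C assume "C \<in> {C. subgraph C H}"
    then have C: "verts C \<subseteq> verts H" "arcs C \<subseteq> arcs H" "tail C = tail H" "head C = head H"
      by (auto simp: subgraph_def compatible_def)
    then have "C = \<lparr>verts = verts C, arcs = arcs C, tail = tail H, head = head H\<rparr>"
      by (cases C) simp
    then show "C \<in> (\<lambda>(A, B). \<lparr>verts = A, arcs = B, tail = tail H, head = head H\<rparr>) `
        (Pow (verts H) \<times> Pow (arcs H))"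
      using C(1,2) by (intro rev_image_eqI[of "(verts C, arcs C)"]) auto
  qed
  show "finite ((\<lambda>(A, B). \<lparr>verts = A, arcs = B, tail = tail H, head = head H\<rparr>) `
      (Pow (verts H) \<times> Pow (arcs H)))"
    using assms by simp
qed

text \<open>Among the finitely many connected subgraphs containing \<open>v\<close>, one of largest
  size is maximal; the single vertex shows that there is one.\<close>

lemma vertex_in_component:
  fixes H :: "('a, 'b) pre_digraph"
  assumes H: "fin_digraph H" and v: "v \<in> verts H"
  shows "\<exists>C\<in>Defs.components H. v \<in> verts C"
proof -
  interpret fin_digraph H by fact
  define Q where "Q = {C. subgraph C H \<and> Digraph_Component.connected C \<and> v \<in> verts C}"
  define P :: "('a, 'b) pre_digraph" where "P = \<lparr>verts = {v}, arcs = {}, tail = tail H, head = head H\<rparr>"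
  have "wf_digraph P" by (simp add: P_def wf_digraph_def)
  then have "subgraph P H"
    using v wf_digraph_axioms by (simp add: subgraph_def P_def compatible_def)
  moreover have "Digraph_Component.connected P"
    by (auto simp: Digraph_Component.connected_def strongly_connected_def mk_symmetric_def P_def reachable_def)
  ultimately have PQ: "P \<in> Q" by (simp add: Q_def P_def)
  have fQ: "finite Q"
    by (rule finite_subset[OF _ finite_subgraphs[of H]]) (auto simp: Q_def)
  \<comment> \<open>Arcs are counted too, since a proper extension may have the same
    vertices.\<close>
  define m where "m = (\<lambda>C :: ('a, 'b) pre_digraph. card (verts C) + card (arcs C))"
  have "Max (m ` Q) \<in> m ` Q"
    using PQ fQ by (intro Max_in) auto
  then obtain C where C: "C \<in> Q" "Max (m ` Q) = m C" by blast
  have max: "m C' \<le> m C" if "C' \<in> Q" for C'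
    unfolding C(2)[symmetric] using that fQ by (intro Max_ge) auto
  have "\<not> (subgraph C' H \<and> Digraph_Component.connected C')" if C': "C' \<noteq> C" "subgraph C C'" for C'
  proof
    assume H': "subgraph C' H \<and> Digraph_Component.connected C'"
    have sub: "verts C \<subseteq> verts C'" "arcs C \<subseteq> arcs C'" "tail C = tail C'" "head C = head C'"
      using C'(2) by (auto simp: subgraph_def compatible_def)
    have fin: "finite (verts C')" "finite (arcs C')"
      using H' finite_subset[OF _ finite_verts] finite_subset[OF _ finite_arcs]
      by (auto simp: subgraph_def)
    have "C' \<in> Q"
      using H' C sub by (auto simp: Q_def)
    then have "m C' \<le> m C" by (rule max)
    moreover have "card (verts C) \<le> card (verts C')" "card (arcs C) \<le> card (arcs C')"
      using sub fin by (auto intro: card_mono)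
    ultimately have "card (verts C) = card (verts C')" "card (arcs C) = card (arcs C')"
      by (auto simp: m_def)
    then have "verts C = verts C'" "arcs C = arcs C'"
      using card_subset_eq[OF fin(1) sub(1)] card_subset_eq[OF fin(2) sub(2)] by simp_all
    then have "C = C'" using sub(3,4) by simp
    with C'(1) show False by simp
  qed
  then have "C \<in> Defs.components H"
    using C unfolding Defs.components_def max_subgraph_def Q_def by blast
  then show ?thesis using C by (auto simp: Q_def)
qed

text \<open>A label is constant on each component and every remaining vertex lies in one, so there
  are at most as many labels as components.\<close>

lemma tough_imp_one_tough:
  assumes G: "pair_graph G" and tough: "tough 1 (with_proj G)"
  shows "one_tough (pverts G) (parcs G)"
  unfolding one_tough_def
proof (intro allI impI)
  fix S and f :: "'a \<Rightarrow> nat"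
  assume S: "S \<subseteq> pverts G"
    and f: "\<forall>u v. (u, v) \<in> parcs G \<longrightarrow> u \<notin> S \<longrightarrow> v \<notin> S \<longrightarrow> f u = f v"
    and c: "1 < card (f ` (pverts G - S))"
  interpret pair_graph G by fact
  define H where "H = delete_verts (with_proj G) S"
  have H: "verts H = pverts G - S" "tail H = fst" "head H = snd"
    "arcs H = {e \<in> parcs G. fst e \<in> pverts G - S \<and> snd e \<in> pverts G - S}"
    by (auto simp: H_def delete_verts_def induce_subgraph_def)
  have fin: "fin_digraph H"
    by unfold_locales (auto simp: H pair_finite_verts pair_finite_arcs)
  interpret H: fin_digraph H by fact
  have fC: "finite (Defs.components H)"
    by (rule finite_subset[OF _ finite_subgraphs[of H]])
       (auto simp: Defs.components_def pre_digraph.max_subgraph_def)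
  define g where "g = (\<lambda>C :: ('a, 'a \<times> 'a) pre_digraph. f (SOME v. v \<in> verts C))"
  have gC: "g C = f v" if C: "C \<in> Defs.components H" and v: "v \<in> verts C" for C v
    unfolding g_def
  proof (rule connected_label_constant[of C])
    have sub: "subgraph C H" and "Digraph_Component.connected C"
      using C by (auto simp: Defs.components_def pre_digraph.max_subgraph_def)
    then show "Digraph_Component.connected C" by simp
    show "(SOME v. v \<in> verts C) \<in> verts C" using v by (rule someI)
    fix e assume "e \<in> arcs C"
    then have "e \<in> arcs H" "tail C = fst" "head C = snd"
      using sub H by (auto simp: subgraph_def compatible_def)
    then show "f (tail C e) = f (head C e)"
      using f H(4) by (cases e) auto
  qed (rule v)
  have "f ` (pverts G - S) \<subseteq> g ` Defs.components H"
  proof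
    fix l assume "l \<in> f ` (pverts G - S)"
    then obtain v where v: "v \<in> verts H" "l = f v" by (auto simp: H)
    then obtain C where "C \<in> Defs.components H" "v \<in> verts C"
      using vertex_in_component[OF fin] by blast
    then show "l \<in> g ` Defs.components H" using gC v(2) by (metis image_eqI)
  qed
  then have le: "card (f ` (pverts G - S)) \<le> num_components H"
    unfolding num_components_def using fC by (rule surj_card_le[rotated])
  then have "real (num_components H) \<le> real (card S)"
    using tough[unfolded tough_def, rule_format, of S] S c le by (simp add: H_def)
  then show "card (f ` (pverts G - S)) \<le> card S"
    using le by linarith
qed

lemma min_degree_le:
  assumes "pair_graph G" "v \<in> pverts G"
  shows "min_degree (with_proj G) \<le> card (parcs G `` {v})"
proof -
  interpret pair_graph G by fact
  have "bij_betw snd (out_arcs (with_proj G) v) (parcs G `` {v})"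
    by (rule bij_betwI[where g = "\<lambda>w. (v, w)"]) (auto simp: out_arcs_def)
  then have "out_degree (with_proj G) v = card (parcs G `` {v})"
    unfolding out_degree_def by (rule bij_betw_same_card)
  moreover have "min_degree (with_proj G) \<le> out_degree (with_proj G) v"
    unfolding min_degree_def using assms(2) pair_finite_verts by (intro Min_le) auto
  ultimately show ?thesis by simp
qed

lemma digraph_isoI:
  assumes G: "pair_graph G" and bij: "bij_betw f (pverts G) (pverts H)"
    and H: "parcs H \<subseteq> pverts H \<times> pverts H"
    and iso: "\<And>u v. u \<in> pverts G \<Longrightarrow> v \<in> pverts G \<Longrightarrow> (u, v) \<in> parcs G \<longleftrightarrow> (f u, f v) \<in> parcs H"
  shows "digraph_iso (with_proj G) (with_proj H)"
proof -
  interpret pair_graph G by fact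
  define h where "h = \<lparr>iso_verts = f, iso_arcs = map_prod f f, iso_head = snd, iso_tail = fst\<rparr>"
  have inj: "inj_on f (pverts G)" and im: "f ` pverts G = pverts H"
    using bij by (auto simp: bij_betw_def)
  have "inj_on (map_prod f f) (parcs G)"
    using map_prod_inj_on[OF inj inj] by (rule inj_on_subset) (auto dest: in_arcsD1 in_arcsD2)
  then have "pre_digraph.digraph_isomorphism (with_proj G) h"
    unfolding pre_digraph.digraph_isomorphism_def
    using inj wf_digraph_axioms by (simp add: h_def)
  moreover have "parcs H = map_prod f f ` parcs G"
  proof
    show "map_prod f f ` parcs G \<subseteq> parcs H"
    proof (clarsimp)
      fix u v assume uv: "(u, v) \<in> parcs G"
      then show "(f u, f v) \<in> parcs H"
        using iso[OF in_arcsD1[OF uv] in_arcsD2[OF uv]] by simp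
    qed
    show "parcs H \<subseteq> map_prod f f ` parcs G"
    proof
      fix e assume e: "e \<in> parcs H"
      then obtain u v where uv: "u \<in> pverts G" "v \<in> pverts G" "e = (f u, f v)"
        using H im by (cases e) blast
      then show "e \<in> map_prod f f ` parcs G"
        using e iso by (intro rev_image_eqI[of "(u, v)"]) auto
    qed
  qed
  then have "with_proj H = app_iso h (with_proj G)"
    by (intro pre_digraph.equality) (auto simp: h_def im)
  ultimately show ?thesis
    unfolding digraph_iso_def by blast
qed

section \<open>The extremal graph\<close>

lemma pverts_M_graph:
  "pverts (M_graph n) = {Inl 0} \<union> Inr ` (Inl ` {..<3} \<union> Inr ` {..<n - 4})"
  by (auto simp: M_graph_def graph_join_def add_edges_def disjoint_union_def complete_graph_def
      complete_plus3_def empty_graph_def)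

lemma parcs_complete_plus3:
  "(Inl i, Inl j) \<notin> parcs (complete_plus3 m)"
  "(Inl i, Inr j) \<in> parcs (complete_plus3 m) \<longleftrightarrow> i = j \<and> i < 3"
  "(Inr j, Inl i) \<in> parcs (complete_plus3 m) \<longleftrightarrow> i = j \<and> i < 3"
  "(Inr j, Inr k) \<in> parcs (complete_plus3 m) \<longleftrightarrow> j < m \<and> k < m \<and> j \<noteq> k"
  by (auto simp: add_edges_def disjoint_union_def complete_graph_def complete_plus3_def empty_graph_def)

lemma parcs_M_graph:
  "(Inl u, Inl v) \<notin> parcs (M_graph n)"
  "(Inl u, Inr y) \<in> parcs (M_graph n) \<longleftrightarrow> u = 0 \<and> Inr y \<in> pverts (M_graph n)"
  "(Inr y, Inl u) \<in> parcs (M_graph n) \<longleftrightarrow> u = 0 \<and> Inr y \<in> pverts (M_graph n)"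
  "(Inr x, Inr y) \<in> parcs (M_graph n) \<longleftrightarrow> (x, y) \<in> parcs (complete_plus3 (n - 4))"
  by (auto simp: M_graph_def graph_join_def add_edges_def disjoint_union_def complete_graph_def)

text \<open>For \<open>7 \<le> n\<close> the complete part has the three vertices at which the
  independent edges end; for smaller \<open>n\<close> these arcs would leave the vertex set.\<close>

lemma ugraph_M_graph:
  assumes "7 \<le> n"
  shows "ugraph (pverts (M_graph n)) (parcs (M_graph n))"
proof
  show "finite (pverts (M_graph n))" by (simp add: pverts_M_graph)
  have in_verts: "u \<in> pverts (M_graph n) \<and> v \<in> pverts (M_graph n)" and sym: "(v, u) \<in> parcs (M_graph n)"
    if "(u, v) \<in> parcs (M_graph n)" for u v
    using that assms
    by (cases u; cases v;
        auto simp: parcs_M_graph pverts_M_graph parcs_complete_plus3 split: sum.splits;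
        rename_tac x y; case_tac x; case_tac y; auto simp: parcs_complete_plus3)+
  show "parcs (M_graph n) \<subseteq> pverts (M_graph n) \<times> pverts (M_graph n)"
    using in_verts by auto
  show "sym (parcs (M_graph n))"
    using sym by (auto intro: symI)
  have "(v, v) \<notin> parcs (M_graph n)" for v
  proof (cases v)
    case (Inr x)
    then show ?thesis by (cases x) (auto simp: parcs_M_graph parcs_complete_plus3)
  qed (simp add: parcs_M_graph)
  then show "irrefl (parcs (M_graph n))"
    by (auto simp: irrefl_def)
qed

text \<open>The vertex of \<open>K\<^sub>1\<close> extends the complete part to a clique on
  \<open>n - 3\<close> vertices, and it has a further neighbour outside that clique.\<close>

lemma spectral_radius_M_graph_gt:
  assumes "7 \<le> n"
  shows "real n - 4 < \<rho> (M_graph n)"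
proof -
  let ?X = "insert (Inl 0) ((Inr \<circ> Inr) ` {..<n - 4}) :: (nat + nat + nat) set"
  have "card ((Inr \<circ> Inr) ` {..<n - 4} :: (nat + nat + nat) set) = n - 4"
    by (subst card_image) (auto simp: inj_on_def)
  then have c: "card ?X = n - 3"
    using assms by (subst card_insert_disjoint) auto
  have "real (card ?X) - 1 < \<rho> (M_graph n)"
  proof (rule clique_index_gt[OF ugraph_M_graph[OF assms]])
    show "graph_index (pverts (M_graph n)) (parcs (M_graph n)) (\<rho> (M_graph n))"
      by (rule graph_index_spectral_radius[OF ugraph_M_graph[OF assms]])
         (simp add: pverts_M_graph)
    show "?X \<subseteq> pverts (M_graph n)" by (auto simp: pverts_M_graph)
    show "(u, v) \<in> parcs (M_graph n)" if "u \<in> ?X" "v \<in> ?X" "u \<noteq> v" for u v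
      using that by (auto simp: parcs_M_graph parcs_complete_plus3 pverts_M_graph)
    show "(Inr (Inl 0), Inl 0) \<in> parcs (M_graph n)"
      by (auto simp: parcs_M_graph pverts_M_graph)
  qed auto
  then show ?thesis using c assms by (simp add: of_nat_diff)
qed

lemma M_graph_bijection:
  assumes X: "card X = n - 3" "7 \<le> n" and V: "V = X \<union> {p, q, r}" "{p, q, r} \<inter> X = {}" "distinct [p, q, r]"
    and clique: "\<And>u v. u \<in> X \<Longrightarrow> v \<in> X \<Longrightarrow> u \<noteq> v \<Longrightarrow> (u, v) \<in> E"
    and E: "ugraph V E"
    and nbrs: "E `` {p} = {c, a}" "E `` {q} = {c, b}" "E `` {r} = {c, d}"
    and distinct: "distinct [c, a, b, d]" "{c, a, b, d} \<subseteq> X"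
  shows "\<exists>f. bij_betw f V (pverts (M_graph n)) \<and>
    (\<forall>u\<in>V. \<forall>v\<in>V. (u, v) \<in> E \<longleftrightarrow> (f u, f v) \<in> parcs (M_graph n))"
proof -
  interpret ugraph V E by fact
  have finX: "finite X" using X by (intro card_ge_0_finite) simp
  obtain ys where ys: "set ys = X - {c, a, b, d}" "distinct ys"
    using finite_distinct_list[of "X - {c, a, b, d}"] finX by auto
  \<comment> \<open>\<open>c\<close> plays the vertex of \<open>K\<^sub>1\<close>. Placing
    \<open>a\<close>, \<open>b\<close>, \<open>d\<close> first makes the \<open>i\<close>-th entry
    of \<open>ws\<close> adjacent to the \<open>i\<close>-th of \<open>xs\<close>, as in
    \<open>complete_plus3\<close>.\<close>
  define xs where "xs = a # b # d # ys"
  define ws where "ws = [p, q, r]"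
  have xs: "distinct xs" "set xs = X - {c}"
    using ys distinct by (auto simp: xs_def)
  have len: "length xs = n - 4"
    using distinct_card[OF xs(1)] xs(2) X finX distinct(2) by simp
  define g :: "nat + nat + nat \<Rightarrow> 'a" where
    "g = case_sum (\<lambda>_. c) (case_sum (\<lambda>i. ws ! i) (\<lambda>j. xs ! j))"
  have g: "g (Inl u) = c" "g (Inr (Inl i)) = ws ! i" "g (Inr (Inr j)) = xs ! j" for u i j
    by (simp_all add: g_def)
  have ws: "ws ! i \<in> {p, q, r}" if "i < 3" for i
    using that by (auto simp: ws_def numeral_3_eq_3 less_Suc_eq)
  have xs_in: "xs ! j \<in> X" "xs ! j \<noteq> c" if "j < n - 4" for j
    using that nth_mem[of j xs] xs(2) len by auto
  have xs_inj: "xs ! i = xs ! j \<longleftrightarrow> i = j" if "i < n - 4" "j < n - 4" for i j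
    using that xs(1) len by (simp add: nth_eq_iff_index_eq)
  have ws_inj: "ws ! i = ws ! j \<longleftrightarrow> i = j" if "i < 3" "j < 3" for i j
    using that V(3) by (subst nth_eq_iff_index_eq) (auto simp: ws_def)
  have cX: "c \<in> X" using distinct by auto
  have im: "g ` pverts (M_graph n) = V"
  proof -
    have "(\<lambda>j. xs ! j) ` {..<n - 4} = set xs"
      using len by (auto simp: in_set_conv_nth image_iff)
    moreover have "(\<lambda>i. ws ! i) ` {..<3} = set ws"
      by (auto simp: ws_def numeral_3_eq_3 lessThan_Suc)
    ultimately have "g ` pverts (M_graph n) = {c} \<union> (set ws \<union> set xs)"
      by (simp add: pverts_M_graph image_Un image_image g)
    then show ?thesis
      using xs(2) cX V(1) by (auto simp: ws_def)
  qed
  have inj: "inj_on g (pverts (M_graph n))"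
  proof (rule inj_onI)
    fix x y assume xy: "x \<in> pverts (M_graph n)" "y \<in> pverts (M_graph n)" "g x = g y"
    have dj: "ws ! i \<noteq> c" "c \<noteq> ws ! i" "ws ! i \<noteq> xs ! j" "xs ! j \<noteq> ws ! i"
      if "i < 3" "j < n - 4" for i j
      using ws[OF that(1)] xs_in[OF that(2)] V(2) cX by auto
    \<comment> \<open>The facts \<open>dj\<close> carry an index \<open>j\<close> even where it does
      not occur; 0 is a valid choice.\<close>
    have n4: "0 < n - 4" using X(2) by simp
    have xc: "c \<noteq> xs ! j" if "j < n - 4" for j
      using xs_in(2)[OF that] by blast
    show "x = y"
      using xy(1,2) unfolding pverts_M_graph
      by (elim UnE imageE singletonE)
         (use xy(3) dj[OF _ n4] dj xs_in xc xs_inj ws_inj in \<open>auto simp: g\<close>)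
  qed
  have adj: "(g x, g y) \<in> E \<longleftrightarrow> (x, y) \<in> parcs (M_graph n)"
    if "x \<in> pverts (M_graph n)" "y \<in> pverts (M_graph n)" for x y
  proof -
    have wx: "(ws ! i, v) \<in> E \<longleftrightarrow> v = c \<or> v = xs ! i" if "i < 3" for i v
    proof -
      have "i = 0 \<or> i = 1 \<or> i = 2" using that by auto
      then show ?thesis
        using nbrs by (auto simp: ws_def xs_def)
    qed
    have less: "i < n - 4" if "i < 3" for i using that X(2) by simp
    have ww: "(ws ! i, ws ! j) \<notin> E" if "i < 3" "j < 3" for i j
      using wx[OF that(1)] ws[OF that(2)] xs_in(1)[OF less[OF that(1)]] V(2) cX by auto
    have wxs: "(ws ! i, xs ! j) \<in> E \<longleftrightarrow> i = j" if "i < 3" "j < n - 4" for i j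
      using wx[OF that(1)] xs_in[OF that(2)] xs_inj[OF that(2) less[OF that(1)]] by auto
    have cw: "(ws ! i, c) \<in> E" if "i < 3" for i
      using wx[OF that] by simp
    have cx: "(xs ! j, c) \<in> E" if "j < n - 4" for j
      using xs_in[OF that] cX by (intro clique) auto
    have xx: "(xs ! j, xs ! k) \<in> E \<longleftrightarrow> j \<noteq> k" if "j < n - 4" "k < n - 4" for j k
      using xs_in[OF that(1)] xs_in[OF that(2)] xs_inj[OF that] no_loop clique by metis
    note flip = wxs[unfolded edge_sym[of "ws ! _"]] cw[unfolded edge_sym[of "ws ! _"]]
      cx[unfolded edge_sym[of "xs ! _"]]
    show ?thesis
      using that ww wxs cw cx xx flip no_loop
      by (auto simp: pverts_M_graph g parcs_M_graph parcs_complete_plus3)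
  qed
  have bij: "bij_betw g (pverts (M_graph n)) V"
    using inj im by (auto simp: bij_betw_def)
  define f where "f = the_inv_into (pverts (M_graph n)) g"
  have "bij_betw f V (pverts (M_graph n))"
    unfolding f_def using bij by (rule bij_betw_the_inv_into)
  moreover have "(u, v) \<in> E \<longleftrightarrow> (f u, f v) \<in> parcs (M_graph n)" if "u \<in> V" "v \<in> V" for u v
  proof -
    have "f w \<in> pverts (M_graph n)" "g (f w) = w" if "w \<in> V" for w
      using that f_the_inv_into_f[OF inj, of w] the_inv_into_into[OF inj, of w] im
      unfolding f_def by auto
    then show ?thesis using adj[of "f u" "f v"] that by simp
  qed
  ultimately show ?thesis by blast
qed

lemma even_card_sym_irrefl:
  assumes "finite E" "sym E" "irrefl E"
  shows "even (card E)"
  using assms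
proof (induction "card E" arbitrary: E rule: less_induct)
  case less
  show ?case
  proof (cases "E = {}")
    case False
    then obtain u v where uv: "(u, v) \<in> E" by auto
    then have vu: "(v, u) \<in> E" and ne: "u \<noteq> v"
      using less.prems by (auto dest: symD simp: irrefl_def)
    let ?F = "E - {(u, v), (v, u)}"
    have c: "card E = card ?F + 2"
      using less.prems(1) uv vu ne card_Diff_subset[of "{(u, v), (v, u)}" E]
        card_mono[of E "{(u, v), (v, u)}"] by simp
    have "sym ?F" "irrefl ?F"
      using less.prems by (auto simp: sym_def irrefl_def)
    then have "even (card ?F)"
      using less.hyps[of ?F] less.prems(1) c by simp
    then show ?thesis using c by simp
  qed simp
qed

theorem theorem1p2:
  fixes G :: "'a pair_pre_digraph" and n :: nat
  assumes "pair_graph G"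
    and "card (pverts G) = n"
    and "n \<ge> 18"
    and "Digraph_Component.connected (with_proj G)"
    and "tough 1 (with_proj G)"
    and "min_degree (with_proj G) \<ge> 2"
    and "\<rho> G \<ge> \<rho> (M_graph n)"
  shows "(\<exists>p. hamiltonian_cycle (with_proj G) p)
    \<or> digraph_iso (with_proj G) (with_proj (M_graph n))"
proof (cases "hamiltonian (pverts G) (parcs G)")
  case True
  then show ?thesis using hamiltonian_imp_hamiltonian_cycle by blast
next
  case False
  define V where "V = pverts G"
  define E where "E = parcs G"
  have n: "card V = n" "18 \<le> n" and non_ham: "\<not> hamiltonian V E"
    using assms(2,3) False by (auto simp: V_def E_def)
  have V_ne: "V \<noteq> {}" using n by auto
  interpret E: ugraph V E
    unfolding V_def E_def by (rule pair_graph_ugraph[OF assms(1)])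
  have toughE: "one_tough V E"
    unfolding V_def E_def by (rule tough_imp_one_tough[OF assms(1,5)])
  obtain F where EF: "E \<subseteq> F" and F: "ugraph V F" "\<not> hamiltonian V F" "ore_closed V F"
    using E.closed_extension[OF non_ham] by blast
  interpret F: ugraph V F by (rule F(1))
  have degF: "2 \<le> card (F `` {v})" if "v \<in> V" for v
  proof -
    have "2 \<le> card (E `` {v})"
      using min_degree_le[OF assms(1), of v] assms(6) that by (simp add: V_def E_def)
    also have "\<dots> \<le> card (F `` {v})"
      using EF by (intro card_mono F.finite_nbrs) auto
    finally show ?thesis .
  qed
  have M: "ugraph (pverts (M_graph n)) (parcs (M_graph n))"
    using n(2) by (intro ugraph_M_graph) simp
  have M_index: "graph_index (pverts (M_graph n)) (parcs (M_graph n)) (\<rho> (M_graph n))"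
    by (rule graph_index_spectral_radius[OF M]) (simp add: pverts_M_graph)
  have E_index: "graph_index V E (\<rho> G)"
    unfolding V_def E_def
    by (rule graph_index_spectral_radius)
       (use E.ugraph_axioms V_ne in \<open>auto simp: V_def E_def\<close>)
  obtain r where r: "graph_index V F r"
    using F.graph_index_exists[OF V_ne] by blast
  have "\<rho> G \<le> r"
    by (rule graph_index_mono[OF E.ugraph_axioms F(1) EF E_index r])
  then have r_gt: "real n - 4 < r"
    using spectral_radius_M_graph_gt[of n] n(2) assms(7) by simp
  \<comment> \<open>For \<open>c \<le> 5\<close> both factors are positive at \<open>n - 4\<close>,
    so the product grows with \<open>r\<close>.\<close>
  have edges: "(real n - 4) * (real n - 4 - real c + 1) < real (card F) - real c * (real n - 1)"
    if "c \<le> 5" "\<And>v. v \<in> V \<Longrightarrow> c \<le> card (F `` {v})" for c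
  proof -
    have "(real n - 4) * (real n - 4 - real c + 1) < r * (r - real c + 1)"
      using r_gt that(1) n(2) by (intro mult_strict_mono) auto
    also have "\<dots> \<le> real (card F) - real c * (real n - 1)"
      using F.index_degree_bound[OF r that(2)] n(1) by simp
    finally show ?thesis .
  qed
  have "closed_dense_graph V F"
  proof
    show "ore_closed V F" by (rule F(3))
    show "18 \<le> card V" using n by simp
    have "real (n * n + 18) < real (card F + 7 * n)"
      using edges[of 2] degF by (simp add: algebra_simps)
    then have "n * n + 18 < card F + 7 * n"
      by (simp only: of_nat_less_iff)
    moreover have "even (card F)"
      by (rule even_card_sym_irrefl[OF F.finite_E F.sym_E F.irrefl_E])
    \<comment> \<open>The two sides of the strict inequality have the same parity, so they differ by
      at least 2.\<close>
    moreover have "even (n * n + 18 + 7 * n)" by simp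
    ultimately have "n * n + 20 \<le> card F + 7 * n"
      by presburger
    then show "card V * card V + 20 \<le> card F + 7 * card V"
      by (simp add: n)
  next
    assume "\<And>v. v \<in> V \<Longrightarrow> 5 \<le> card (F `` {v})"
    then have "real (n * n + 27) < real (card F + 7 * n)"
      using edges[of 5] by (simp add: algebra_simps)
    then have "n * n + 27 < card F + 7 * n"
      by (simp only: of_nat_less_iff)
    then show "card V * card V + 28 \<le> card F + 7 * card V"
      by (simp add: n)
  qed
  then obtain X where X: "X \<subseteq> V" "card (V - X) = 3"
    and clique: "\<And>u v. u \<in> X \<Longrightarrow> v \<in> X \<Longrightarrow> u \<noteq> v \<Longrightarrow> (u, v) \<in> F"
    using closed_dense_graph.large_clique by blast
  have cX: "card X = n - 3"
    using X n(1) card_Diff_subset[of X V] F.finite_V card_mono[OF F.finite_V X(1)]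
    by (simp add: finite_subset)
  interpret tough_clique_graph V F X
  proof
    show "one_tough V F" using toughE EF by (rule one_tough_mono)
    show "5 \<le> card X" using cX n by simp
    show "ore_closed V F" "\<not> hamiltonian V F" "X \<subseteq> V" "card (V - X) = 3"
      by (fact F(3) F(2) X(1) X(2))+
    show "2 \<le> card (F `` {v})" if "v \<in> V" for v
      using that by (rule degF)
    show "(u, v) \<in> F" if "u \<in> X" "v \<in> X" "u \<noteq> v" for u v
      using that by (rule clique)
  qed
  obtain p q s c a b d where W: "V - X = {p, q, s}" "distinct [p, q, s]"
    and nbrs: "F `` {p} = {c, a}" "F `` {q} = {c, b}" "F `` {s} = {c, d}"
    and star: "distinct [c, a, b, d]" "{c, a, b, d} \<subseteq> X"
    by (rule outside_star)
  have VX: "V = X \<union> {p, q, s}" "{p, q, s} \<inter> X = {}"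
    using X(1) W(1) by auto
  obtain f where bij: "bij_betw f V (pverts (M_graph n))"
    and iso: "\<And>u v. u \<in> V \<Longrightarrow> v \<in> V \<Longrightarrow> (u, v) \<in> F \<longleftrightarrow> (f u, f v) \<in> parcs (M_graph n)"
    using M_graph_bijection[OF cX _ VX W(2) clique F(1) nbrs star] n(2) by auto
  have "r \<le> \<rho> (M_graph n)"
    by (rule graph_index_iso[OF M bij F(1) iso M_index r])
  \<comment> \<open>Together with \<open>\<rho> G \<le> r\<close> this makes the indices of
    \<open>E\<close> and \<open>F\<close> equal.\<close>
  then have "r \<le> \<rho> G" using assms(7) by simp
  moreover have "(u, v) \<in> F\<^sup>*" if "u \<in> V" "v \<in> V" for u v
  proof -
    \<comment> \<open>The centre \<open>c\<close> is adjacent to every other vertex, so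
      \<open>F\<close> is connected.\<close>
    have "(w, c) \<in> F\<^sup>*" if "w \<in> V" for w
    proof (cases "w = c")
      case False
      then have "(w, c) \<in> F"
        using that nbrs star(2) clique[of w c] unfolding VX(1) by auto
      then show ?thesis by blast
    qed simp
    then have "(u, c) \<in> F\<^sup>*" "(v, c) \<in> F\<^sup>*" using that by auto
    then show ?thesis
      using F.sym_E by (meson rtrancl_trans sym_rtrancl symD)
  qed
  ultimately have "E = F"
    using graph_index_strict_mono[OF E.ugraph_axioms F(1) EF _ E_index r] by blast
  then have "digraph_iso (with_proj G) (with_proj (M_graph n))"
    using bij iso ugraph.edge_verts[OF M]
    by (intro digraph_isoI[OF assms(1)]) (auto simp: V_def E_def)
  then show ?thesis ..
qed

end
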